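(* Let $h$ be a positive integer and let $M \in \mathbb{F}_2[x]$ be a Mersenne prime (polynomial). Then $\sigma(M^{2h})$ is divisible by an irreducible polynomial which is not a Mersenne prime in each of the following cases: (i) $M \in \{M_1, M_3, \overline{M_3}\}$, or ($M \in \{M_2,\overline{M_2}\}$ and $h \geq 2$). (ii) $M \notin \{M_1, M_2,\overline{M_2},M_3,\overline{M_3}\}$ and $2h+1$ is divisible by a prime number $p \in \Delta\setminus\{7\}$.
   Context: For nonzero $A \in \mathbb{F}_2[x]$, $\sigma(A)$ denotes the sum of all divisors of $A$ in $\mathbb{F}_2[x]$ (including $1$ and $A$); so $\sigma(M^{2h}) = 1+M+\cdots+M^{2h}$ for $M$ irreducible. A Mersenne prime (polynomial) over $\mathbb{F}_2$ is an irreducible polynomial of the form $1+x^c(x+1)^d$ with $c,d$ positive integers. For $S \in \mathbb{F}_2[x]$, $\overline{S}(x)=S(x+1)$. For $j\in\{1,2,3\}$, $M_j = 1+x(x+1)^j$. $\Delta$ is the set of prime numbers $p$ such that either $p$ is a Mersenne prime number (a prime of the form $2^m-1$), or the multiplicative order $\mathrm{ord}_p(2)$ of $2$ in $\mathbb{F}_p\setminus\{0\}$ is divisible by $8$. *)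

theory Defs
  imports
    "HOL-Library.Z2"
    "HOL-Computational_Algebra.Computational_Algebra"
    "HOL-Number_Theory.Number_Theory"
begin

text \<open>The field with two elements is the type \<^typ>\<open>bit\<close>, so \<^typ>\<open>bit poly\<close> is its polynomial ring.\<close>

abbreviation polyX :: "bit poly"
  where "polyX \<equiv> [:0, 1:]"

text \<open>
  The only unit of \<^typ>\<open>bit poly\<close> is \<open>1\<close>, so distinct divisors are never associated and no
  normalisation is needed here. For \<open>A = 0\<close> the index set is infinite and the value is \<open>0\<close>.
\<close>

definition sigma_poly :: "bit poly \<Rightarrow> bit poly"
  where "sigma_poly A = (\<Sum>D | D dvd A. D)"

lemma finite_divisors_bit_poly:
  fixes A :: "bit poly"
  assumes "A \<noteq> 0"
  shows "finite {D. D dvd A}"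
proof -
  have "finite (UNIV :: bit set)"
    by (rule finite_subset[of _ "{0, 1}"]) (use bit_not_zero_iff in blast, simp)
  then have "finite {xs :: bit list. set xs \<subseteq> UNIV \<and> length xs \<le> Suc (degree A)}"
    by (rule finite_lists_length_le)
  moreover have "coeffs ` {D. D dvd A} \<subseteq> {xs. set xs \<subseteq> UNIV \<and> length xs \<le> Suc (degree A)}"
  proof safe
    fix D assume "D dvd A"
    with assms have "D \<noteq> 0" "degree D \<le> degree A"
      by (auto intro: dvd_imp_degree_le)
    then show "length (coeffs D) \<le> Suc (degree A)"
      by (simp add: length_coeffs)
  qed auto
  ultimately have "finite (coeffs ` {D. D dvd A})"
    by (rule finite_subset[rotated])
  then show ?thesis
    by (rule finite_imageD) (auto intro: inj_onI simp: coeffs_eq_iff)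
qed

definition mersenne_prime_poly :: "bit poly \<Rightarrow> bool"
  where "mersenne_prime_poly M \<longleftrightarrow>
    irreducible M \<and> (\<exists>c d. c > 0 \<and> d > 0 \<and> M = 1 + polyX ^ c * (polyX + 1) ^ d)"

definition bar_poly :: "bit poly \<Rightarrow> bit poly"
  where "bar_poly S = pcompose S (polyX + 1)"

definition Mersenne_M :: "nat \<Rightarrow> bit poly"
  where "Mersenne_M j = 1 + polyX * (polyX + 1) ^ j"

definition mersenne_prime_nat :: "nat \<Rightarrow> bool"
  where "mersenne_prime_nat p \<longleftrightarrow> prime p \<and> (\<exists>m. p = 2 ^ m - 1)"

text \<open>
  The condition \<open>p \<noteq> 2\<close> says that \<open>2\<close> is a nonzero residue, so that its order is defined;
  the library sets \<open>ord 2 2 = 0\<close>, which \<open>8\<close> would divide.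
\<close>

definition Delta :: "nat set"
  where "Delta = {p. prime p \<and> (mersenne_prime_nat p \<or> (p \<noteq> 2 \<and> 8 dvd ord p 2))}"

end

theory Submission
  imports Defs "HOL-Algebra.Algebraic_Closure_Type"
begin

text \<open>
  Write \<open>y = x + 1\<close>, \<open>M = 1 + x\<^sup>a y\<^sup>b\<close>, \<open>n = a + b\<close>. If a prime \<open>q\<close> divides \<open>2h + 1\<close>, then
  \<open>V = 1 + M + \<dots> + M\<^bsup>q-1\<^esup>\<close> divides \<open>\<sigma>(M\<^bsup>2h\<^esup>)\<close>, and the degree \<open>d\<close> of every irreducible factor of \<open>V\<close>
  satisfies \<open>q | 2\<^sup>d - 1\<close>, because \<open>M\<close> takes a primitive \<open>q\<close>-th root of unity as value at its roots.

  If \<open>8 | ord\<^sub>q(2)\<close>, then \<open>8 | d\<close>, and no Mersenne polynomial of degree divisible by \<open>8\<close> is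
  irreducible: in the coordinate \<open>x/(x + 1)\<close> it becomes \<open>x\<^sup>a + (x + 1)\<^sup>n\<close>, whose Taylor coefficients at a
  root are nearly those of \<open>x\<^sup>a\<close>, so that Stickelberger's parity criterion applies.
  If \<open>q = 2\<^sup>m - 1\<close>, then every irreducible polynomial of degree \<open>m\<close> other than \<open>M\<close> divides \<open>V\<close>; for
  \<open>m \<ge> 5\<close> there are more of these than Mersenne polynomials of degree \<open>m\<close>, and for \<open>q = 3\<close> the factor
  \<open>1 + x + x\<^sup>2\<close> leads to a contradiction. In general, if all factors of \<open>V\<close> were Mersenne
  polynomials of large degree compared to \<open>n\<close>, then the leading coefficients of \<open>V\<close> would be those of some
  \<open>x\<^sup>u y\<^sup>v\<close>, which they are not; this leaves finitely many \<open>q\<close> for \<open>M\<^sub>1\<close>, \<open>M\<^sub>2\<close> and \<open>M\<^sub>3\<close>.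
\<close>

hide_const (open) Divisibility.irreducible Divisibility.prime Coset.order Polynomials.degree
  Polynomials.lead_coeff module.smult up_ring.monom up_ring.coeff

section \<open>Characteristic two\<close>

lemma bit_add_self [simp]: "(a :: bit) + a = 0"
  by (cases a) simp_all

lemma bit_poly_add_self [simp]: "(p :: bit poly) + p = 0"
  by (rule poly_eqI) (simp only: coeff_add bit_add_self coeff_0)

lemma bit_poly_two [simp]: "(2 :: bit poly) = 0"
  using bit_poly_add_self[of 1] by (simp only: one_add_one)

lemma bit_poly_uminus [simp]: "- (p :: bit poly) = p"
  by (metis add.inverse_unique bit_poly_add_self)

lemma ac_two [simp]: "(2 :: bit alg_closure) = 0"
  by (metis to_ac_numeral to_ac_0 bit_2_eq_0)

lemma ac_add_self [simp]: "(x :: bit alg_closure) + x = 0"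
  by (metis mult_2 ac_two mult_zero_left)

lemma ac_uminus [simp]: "- (x :: bit alg_closure) = x"
  by (metis add.inverse_unique ac_add_self)

lemma ac_add_eq_0_iff: "(x :: bit alg_closure) + y = 0 \<longleftrightarrow> x = y"
  by (metis add.inverse_unique ac_uminus ac_add_self)

lemma ac_of_nat: "of_nat n = (if even n then 0 else 1 :: bit alg_closure)"
  by (induction n) auto

lemma ac_add_power2: "((x :: bit alg_closure) + y) ^ 2 = x ^ 2 + y ^ 2"
  by (simp add: power2_sum)

lemma ac_sum_power2: "(\<Sum>i\<in>A. f i :: bit alg_closure) ^ 2 = (\<Sum>i\<in>A. f i ^ 2)"
  by (induction A rule: infinite_finite_induct) (simp_all add: ac_add_power2)

lemma ac_add_power2_power: "((x :: bit alg_closure) + y) ^ (2 ^ k) = x ^ (2 ^ k) + y ^ (2 ^ k)"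
  by (induction k) (simp_all add: power_mult ac_add_power2 mult.commute[of 2])

lemma ac_power2_power_inj: "(x :: bit alg_closure) ^ (2 ^ k) = y ^ (2 ^ k) \<Longrightarrow> x = y"
  by (metis ac_add_power2_power ac_add_eq_0_iff power_eq_0_iff)

text \<open>The fixed field of Frobenius is the prime field, since
  \<open>x^2 + x = x (x + 1)\<close>. Polynomials over the closure descend to
  \<open>bit poly\<close> by this criterion.\<close>

lemma ac_power2_eq_self_iff: "(x :: bit alg_closure) ^ 2 = x \<longleftrightarrow> x \<in> range to_ac"
proof
  assume "x ^ 2 = x"
  have "x * (x + 1) = x ^ 2 + x"
    by (simp only: power2_eq_square distrib_left mult_1_right)
  also have "\<dots> = 0"
    using \<open>x ^ 2 = x\<close> by simp
  finally have "x * (x + 1) = 0" .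
  then have "x = 0 \<or> x + 1 = 0"
    by simp
  then have "x = to_ac 0 \<or> x = to_ac 1"
    by (simp add: ac_add_eq_0_iff)
  then show "x \<in> range to_ac" by blast
next
  have "to_ac a ^ 2 = to_ac a" for a :: bit
    by (cases a) simp_all
  then show "x \<in> range to_ac \<Longrightarrow> x ^ 2 = x" by auto
qed

section \<open>Evaluation in the algebraic closure\<close>

definition ev :: "bit poly \<Rightarrow> bit alg_closure \<Rightarrow> bit alg_closure"
  where "ev p x = poly (map_poly to_ac p) x"

lemma ev_pCons [simp]: "ev (pCons a p) x = to_ac a + x * ev p x"
  by (simp add: ev_def map_poly_pCons)

lemma ev_0 [simp]: "ev 0 x = 0"
  by (simp add: ev_def)

lemma ev_1 [simp]: "ev 1 x = 1"
  by (simp add: ev_def)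

lemma ev_add [simp]: "ev (p + q) x = ev p x + ev q x"
proof -
  have "map_poly to_ac (p + q) = map_poly to_ac p + map_poly to_ac q"
    by (rule poly_eqI) (simp add: coeff_map_poly del: add_bit_eq_xor)
  then show ?thesis by (simp add: ev_def)
qed

lemma ev_smult [simp]: "ev (smult a p) x = to_ac a * ev p x"
  by (cases a) simp_all

lemma ev_mult [simp]: "ev (p * q) x = ev p x * ev q x"
  by (induction p) (simp_all add: algebra_simps)

lemma ev_power [simp]: "ev (p ^ n) x = ev p x ^ n"
  by (induction n) simp_all

lemma ev_sum: "ev (\<Sum>i\<in>A. f i) x = (\<Sum>i\<in>A. ev (f i) x)"
  by (induction A rule: infinite_finite_induct) simp_all

lemma ev_power2: "ev p (x ^ 2) = ev p x ^ 2"
proof (induction p)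
  case (pCons a p)
  have "to_ac a ^ 2 = to_ac a"
    using ac_power2_eq_self_iff by blast
  with pCons show ?case
    by (simp add: ac_add_power2 power_mult_distrib)
qed simp

lemma ev_power2_power: "ev p (x ^ (2 ^ k)) = ev p x ^ (2 ^ k)"
  by (induction k) (simp_all add: power_mult ev_power2 mult.commute[of 2])

lemma degree_map_to_ac [simp]: "degree (map_poly to_ac p) = degree (p :: bit poly)"
  by (rule degree_map_poly) simp

lemma bit_poly_is_unit_iff: "(p :: bit poly) dvd 1 \<longleftrightarrow> p = 1"
proof
  assume "p dvd 1"
  then obtain c where "p = [:c:]" "c \<noteq> 0"
    by (metis is_unit_poly_iff dvd_field_iff zero_neq_one)
  then show "p = 1" by (simp add: one_pCons)
qed simp

lemma bit_poly_degree_0: "(p :: bit poly) \<noteq> 0 \<Longrightarrow> degree p = 0 \<Longrightarrow> p = 1"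
  using is_unit_iff_degree bit_poly_is_unit_iff by blast

lemma irreducible_degree_pos: "irreducible (P :: bit poly) \<Longrightarrow> degree P > 0"
  using bit_poly_degree_0 by (fastforce simp: Factorial_Ring.irreducible_def)

lemma ex_ev_root:
  assumes "degree p > 0"
  obtains x where "ev p x = 0"
  using alg_closed_imp_poly_has_root[of "map_poly to_ac p"] assms by (auto simp: ev_def)

lemma finite_ev_roots: "p \<noteq> 0 \<Longrightarrow> finite {x. ev p x = 0} \<and> card {x. ev p x = 0} \<le> degree p"
proof -
  assume "p \<noteq> 0"
  then have "map_poly to_ac p \<noteq> 0"
    by (simp add: map_poly_eq_0_iff)
  then show ?thesis
    using poly_roots_finite[of "map_poly to_ac p"] card_poly_roots_bound[of "map_poly to_ac p"]
    by (simp add: ev_def)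
qed

text \<open>A nonzero polynomial \<open>Q\<close> of least degree vanishing at \<open>x\<close>
  divides every other one by division with remainder; irreducibility of \<open>P\<close> forces
  \<open>P = Q\<close>.\<close>

lemma irreducible_ev_dvd:
  assumes P: "irreducible P" and x: "ev P x = 0" and F: "ev F x = 0"
  shows "P dvd F"
proof -
  define S where "S = {Q. Q \<noteq> 0 \<and> ev Q x = 0}"
  have "P \<in> S" using P x by (auto simp: S_def)
  then obtain Q where Q: "Q \<in> S" and min: "\<And>R. R \<in> S \<Longrightarrow> degree Q \<le> degree R"
    using ex_has_least_nat[of "\<lambda>Q. Q \<in> S" P degree] by blast
  have dvd: "Q dvd R" if "ev R x = 0" for R
  proof (rule ccontr)
    assume nd: "\<not> Q dvd R"
    have "ev R x = ev (R div Q) x * ev Q x + ev (R mod Q) x"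
      by (metis div_mult_mod_eq ev_add ev_mult)
    then have "ev (R mod Q) x = 0"
      using that Q by (simp add: S_def)
    moreover have "R mod Q \<noteq> 0" using nd by (simp add: dvd_eq_mod_eq_0)
    ultimately have "degree Q \<le> degree (R mod Q)"
      by (intro min) (simp add: S_def)
    with \<open>R mod Q \<noteq> 0\<close> Q degree_mod_less[of Q R] show False
      by (auto simp: S_def)
  qed
  obtain R where R: "P = Q * R" using dvd[OF x] by blast
  have "\<not> Q dvd 1"
    using Q by (auto simp: bit_poly_is_unit_iff S_def)
  then have "R dvd 1" using Factorial_Ring.irreducibleD[OF P R] by blast
  then show ?thesis using dvd[OF F] R by (simp add: bit_poly_is_unit_iff)
qed

lemma ex_irreducible_root_factor:
  assumes "V \<noteq> 0" "ev V x = 0"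
  shows "\<exists>P. irreducible P \<and> P dvd V \<and> ev P x = 0"
  using assms
proof (induction "degree V" arbitrary: V rule: less_induct)
  case less
  show ?case
  proof (cases "irreducible V")
    case True
    then show ?thesis using less.prems by auto
  next
    case False
    have "\<not> V dvd 1"
      using less.prems by (auto simp: bit_poly_is_unit_iff)
    with False less.prems obtain A B where AB: "V = A * B" "\<not> A dvd 1" "\<not> B dvd 1"
      by (auto simp: Factorial_Ring.irreducible_def)
    have nz: "A \<noteq> 0" "B \<noteq> 0" using AB less.prems by auto
    then have "degree A > 0" "degree B > 0"
      using AB(2,3) bit_poly_degree_0 bit_poly_is_unit_iff by blast+
    then have deg: "degree A < degree V" "degree B < degree V"
      using AB nz by (auto simp: degree_mult_eq)
    have "ev A x = 0 \<or> ev B x = 0" using less.prems AB by simp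
    then show ?thesis
      using less.hyps[OF deg(1) nz(1)] less.hyps[OF deg(2) nz(2)] AB(1) by (meson dvd_mult dvd_mult2)
  qed
qed

lemma ex_irreducible_factor:
  assumes "degree V > 0"
  obtains P :: "bit poly" where "irreducible P" "P dvd V"
proof -
  obtain x where "ev V x = 0" using ex_ev_root[OF assms] .
  moreover have "V \<noteq> 0" using assms by auto
  ultimately show ?thesis using ex_irreducible_root_factor that by blast
qed

text \<open>The cross terms of \<open>p^2\<close> vanish in characteristic two. Serves to show that
  a product over a Frobenius orbit has coefficients in the prime field.\<close>

lemma pcompose_map_poly_power2:
  fixes p :: "bit alg_closure poly"
  shows "pcompose (map_poly (\<lambda>c. c ^ 2) p) [:0, 0, 1:] = p ^ 2"
proof (induction p)
  case (pCons a p)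
  have two: "(2 :: bit alg_closure poly) = 0"
    by (metis ac_two numeral_poly pCons_0_0)
  have "(pCons a p) ^ 2 = ([:a:] + [:0, 1:] * p) ^ 2"
    by simp
  also have "\<dots> = [:a:] ^ 2 + [:0, 1:] ^ 2 * p ^ 2"
    by (simp only: power2_sum two power_mult_distrib) simp
  also have "\<dots> = [:a ^ 2:] + [:0, 0, 1:] * p ^ 2"
    by (simp add: power2_eq_square)
  finally show ?case using pCons
    by (simp add: map_poly_pCons pcompose_pCons)
qed simp

text \<open>The orbit of \<open>x\<close> under Frobenius consists of roots of \<open>P\<close>, so
  its length \<open>e\<close> is at most \<open>degree P\<close>. The product of the
  \<open>X + x^(2^i)\<close> over the orbit is Frobenius invariant, hence has coefficients in the
  prime field and is divisible by \<open>P\<close>, so \<open>e\<close> is also at least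
  \<open>degree P\<close>.\<close>

lemma frobenius_orbit:
  assumes P: "irreducible P" and x: "ev P x = 0"
  shows "x ^ (2 ^ degree P) = x" and "inj_on (\<lambda>i. x ^ (2 ^ i)) {..<degree P}"
proof -
  have roots: "ev P (x ^ (2 ^ i)) = 0" for i
    using x by (simp add: ev_power2_power)
  have P0: "P \<noteq> 0" using P by auto
  have fin: "finite {x. ev P x = 0}" using finite_ev_roots[OF P0] by blast
  have "\<not> inj (\<lambda>i. x ^ (2 ^ i))"
  proof
    assume "inj (\<lambda>i. x ^ (2 ^ i))"
    then have "infinite (range (\<lambda>i. x ^ (2 ^ i)))"
      using finite_imageD infinite_UNIV_nat by blast
    moreover have "range (\<lambda>i. x ^ (2 ^ i)) \<subseteq> {x. ev P x = 0}"
      using roots by auto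
    ultimately show False using fin finite_subset by blast
  qed
  then obtain i j :: nat where ij: "i < j" "x ^ (2 ^ i) = x ^ (2 ^ j)"
    unfolding inj_def by (metis linorder_neqE_nat)
  \<comment> \<open>Injectivity of Frobenius removes a preperiod: any repetition in the orbit is a
    return to \<open>x\<close> itself.\<close>
  have shift: "x ^ (2 ^ k) = x" if "x ^ (2 ^ i) = x ^ (2 ^ (i + k))" for i k
  proof (rule ac_power2_power_inj)
    show "(x ^ (2 ^ k)) ^ (2 ^ i) = x ^ (2 ^ i)"
      using that by (simp add: power_add mult.commute flip: power_mult)
  qed
  have "\<exists>e. e > 0 \<and> x ^ (2 ^ e) = x"
    using shift[of i "j - i"] ij by (intro exI[of _ "j - i"]) simp
  then obtain e where e: "e > 0" "x ^ (2 ^ e) = x"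
      and min: "\<And>k. k > 0 \<Longrightarrow> x ^ (2 ^ k) = x \<Longrightarrow> e \<le> k"
    using exists_least_iff[of "\<lambda>e. e > 0 \<and> x ^ (2 ^ e) = x"] by (metis not_less)
  have inj: "inj_on (\<lambda>i. x ^ (2 ^ i)) {..<e}"
  proof (rule linorder_inj_onI)
    fix i j assume *: "i < j" "i \<in> {..<e}" "j \<in> {..<e}"
    show "x ^ (2 ^ i) \<noteq> x ^ (2 ^ j)"
    proof
      assume "x ^ (2 ^ i) = x ^ (2 ^ j)"
      then have "x ^ (2 ^ (j - i)) = x"
        using shift[of i "j - i"] * by simp
      then have "e \<le> j - i" using min[of "j - i"] * by simp
      then show False using * by simp
    qed
  qed auto
  have "e = card ((\<lambda>i. x ^ (2 ^ i)) ` {..<e})"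
    using inj by (simp add: card_image)
  also have "\<dots> \<le> card {x. ev P x = 0}"
    using fin roots by (intro card_mono) auto
  also have "\<dots> \<le> degree P" using finite_ev_roots[OF P0] by blast
  finally have le: "e \<le> degree P" .
  define Q where "Q = (\<Prod>i<e. [:x ^ (2 ^ i), 1:])"
  have Q0: "Q \<noteq> 0" by (simp add: Q_def)
  have degQ: "degree Q = e"
    unfolding Q_def by (subst degree_prod_eq_sum_degree) auto
  have "pcompose Q [:0, 0, 1:] = (\<Prod>i<e. [:x ^ (2 ^ i), 0, 1:])"
    by (simp add: Q_def pcompose_prod pcompose_pCons)
  \<comment> \<open>The orbit is cyclic: shifting the index replaces the factor at \<open>0\<close>
    by the equal factor at \<open>e\<close>.\<close>
  also have "\<dots> = (\<Prod>i<e. [:x ^ (2 ^ Suc i), 0, 1:])"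
  proof -
    define f where "f = (\<lambda>i. [:x ^ (2 ^ i), 0, 1:])"
    have "f e = f 0" using e by (simp add: f_def)
    have "f 0 * (\<Prod>i<e. f (Suc i)) = f 0 * (\<Prod>i<e. f i)"
      using prod.lessThan_Suc_shift[of f e] prod.lessThan_Suc[of f e] \<open>f e = f 0\<close>
      by (metis mult.commute)
    moreover have "f 0 \<noteq> 0" by (simp add: f_def)
    ultimately have "(\<Prod>i<e. f (Suc i)) = (\<Prod>i<e. f i)" by (metis mult_cancel_left)
    then show ?thesis unfolding f_def by (rule sym)
  qed
  also have "\<dots> = Q ^ 2"
    unfolding Q_def prod_power_distrib
    by (intro prod.cong) (simp_all add: power2_eq_square mult.commute[of 2] power_mult)
  also have "\<dots> = pcompose (map_poly (\<lambda>c. c ^ 2) Q) [:0, 0, 1:]"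
    by (rule pcompose_map_poly_power2[symmetric])
  finally have "pcompose (Q - map_poly (\<lambda>c. c ^ 2) Q) [:0, 0, 1:] = 0"
    by (simp add: pcompose_diff)
  then have "Q - map_poly (\<lambda>c. c ^ 2) Q = 0"
    by (rule pcompose_eq_0) simp
  then have "coeff Q k ^ 2 = coeff Q k" for k
    by (metis coeff_map_poly right_minus_eq zero_power2)
  then have rng: "coeff Q k \<in> range to_ac" for k
    using ac_power2_eq_self_iff by blast
  define q where "q = map_poly of_ac Q"
  have Qq: "Q = map_poly to_ac q"
    by (rule poly_eqI) (simp add: q_def coeff_map_poly to_ac_of_ac[OF rng])
  have "poly Q x = 0"
    using e by (auto simp: Q_def poly_prod prod_zero_iff intro!: bexI[of _ 0])
  then have "ev q x = 0" by (simp add: ev_def Qq)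
  then have "P dvd q" by (rule irreducible_ev_dvd[OF P x])
  moreover have "q \<noteq> 0" using Q0 Qq by auto
  ultimately have "degree P \<le> degree q" by (rule dvd_imp_degree_le)
  also have "degree q = e" using degQ Qq by simp
  finally have "degree P = e" using le by simp
  then show "x ^ (2 ^ degree P) = x" "inj_on (\<lambda>i. x ^ (2 ^ i)) {..<degree P}"
    using e inj by auto
qed

section \<open>Roots and factor degrees of geometric sums\<close>

lemma power_eq_1_coprime:
  fixes u :: "'a :: monoid_mult" and a b :: nat
  assumes "u ^ a = 1" "u ^ b = 1" "coprime a b" "a \<noteq> 0"
  shows "u = 1"
proof -
  obtain x y where "a * x = b * y + 1"
    using bezout_nat[of a b] assms by auto
  then have "u ^ (a * x) = u ^ (b * y) * u" by (simp add: power_commutes)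
  then show ?thesis using assms by (simp add: power_mult)
qed

text \<open>Telescoping gives a \<open>q\<close>-th root of unity. The value 1 is excluded because
  the sum would then be \<open>q\<close>, which is 1 for odd \<open>q\<close>.\<close>

lemma geometric_root:
  assumes "ev (\<Sum>i<q. M ^ i) x = 0" "odd q"
  shows "ev M x ^ q = 1" "ev M x \<noteq> 1" "ev M x \<noteq> 0"
proof -
  have s: "(\<Sum>i<q. ev M x ^ i) = 0" using assms by (simp add: ev_sum)
  show *: "ev M x ^ q = 1"
    using power_diff_1_eq[of "ev M x" q] s by simp
  show "ev M x \<noteq> 1"
    using s assms by (auto simp: ac_of_nat)
  show "ev M x \<noteq> 0"
    using * assms by (metis odd_pos power_0_left zero_neq_one less_numeral_extra(3))
qed

text \<open>At a root of \<open>P\<close> the value of \<open>M\<close> lies in the field with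
  \<open>2^degree P\<close> elements. If \<open>q\<close> were coprime to the order of its unit
  group, a \<open>q\<close>-th root of unity there would be trivial. The coprimality form also
  covers the composite exponent 9.\<close>

lemma geometric_factor_degree:
  fixes P :: "bit poly"
  assumes P: "irreducible P" "P dvd (\<Sum>i<q. M ^ i)" and q: "odd q"
  shows "\<not> coprime q (2 ^ degree P - 1)"
proof
  assume coprime: "coprime q (2 ^ degree P - 1)"
  obtain x where x: "ev P x = 0" using ex_ev_root irreducible_degree_pos[OF P(1)] by blast
  then have "ev (\<Sum>i<q. M ^ i) x = 0" using P(2) by (auto elim!: dvdE)
  note M = geometric_root[OF this q]
  have "ev M x ^ (2 ^ degree P) = ev M x"
    using frobenius_orbit(1)[OF P(1) x] ev_power2_power[of M x "degree P"] by simp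
  then have "ev M x * ev M x ^ (2 ^ degree P - 1) = ev M x * 1"
    by (simp flip: power_Suc)
  then have "ev M x ^ (2 ^ degree P - 1) = 1"
    using M(3) by (metis mult_cancel_left)
  then have "ev M x = 1"
    using power_eq_1_coprime M(1) coprime odd_pos[OF q] by blast
  then show False using M(2) by simp
qed

section \<open>Mersenne polynomials of degree divisible by eight\<close>

lemma mersenne_degree [simp]: "degree (1 + polyX ^ a * (polyX + 1) ^ b) = a + b"
proof (cases "a + b = 0")
  case False
  have "degree (polyX ^ a * (polyX + 1) ^ b) = a + b"
    by (simp add: degree_mult_eq degree_power_eq one_pCons)
  then show ?thesis using False by (subst degree_add_eq_right) auto
qed simp

text \<open>With both exponents even, the polynomial is the square of
  \<open>1 + x^(a/2) (x + 1)^(b/2)\<close>.\<close>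

lemma mersenne_not_both_even:
  assumes irr: "irreducible (1 + polyX ^ a * (polyX + 1) ^ b)"
  shows "odd a \<or> odd b"
proof (rule ccontr)
  assume "\<not> (odd a \<or> odd b)"
  then obtain c d where cd: "a = 2 * c" "b = 2 * d" by (auto elim!: evenE)
  define g where "g = 1 + polyX ^ c * (polyX + 1) ^ d"
  have "1 + polyX ^ a * (polyX + 1) ^ b = g ^ 2"
    by (simp add: g_def cd power2_sum power_mult_distrib mult.commute[of 2] flip: power_mult)
  then have "1 + polyX ^ a * (polyX + 1) ^ b = g * g"
    by (simp add: power2_eq_square)
  then have "g dvd 1"
    using Factorial_Ring.irreducibleD[OF irr] by blast
  then have "degree g = 0" by (simp add: bit_poly_is_unit_iff)
  then have "a + b = 0" by (simp add: g_def cd)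
  then show False using irr by (simp add: Factorial_Ring.irreducible_def)
qed

lemma mersenne_root:
  assumes "ev (1 + polyX ^ a * (polyX + 1) ^ b) x = 0" "a > 0" "b > 0"
  shows "x ^ a * (x + 1) ^ b = 1" "x \<noteq> 0" "x + 1 \<noteq> 0"
proof -
  show *: "x ^ a * (x + 1) ^ b = 1"
    using assms(1) ac_add_eq_0_iff[of 1] by (simp add: add.commute)
  show "x \<noteq> 0" using * assms by (auto simp: power_0_left)
  show "x + 1 \<noteq> 0" using * assms by (auto simp: power_0_left)
qed

text \<open>Newton's identity for the third power sum in characteristic two; \<open>e A k\<close> is
  the \<open>k\<close>-th elementary symmetric function of the \<open>r i\<close>.\<close>

lemma sum_cubes_elementary_symmetric:
  fixes r :: "'i \<Rightarrow> bit alg_closure"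
  defines "e \<equiv> \<lambda>A. coeff (\<Prod>i\<in>A. [:1, r i:])"
  assumes "finite A"
  shows "(\<Sum>i\<in>A. r i ^ 3) = e A 1 ^ 3 + e A 1 * e A 2 + e A 3 \<and> e A 0 = 1"
  using assms(2)
proof (induction A)
  case empty
  then show ?case by (simp add: e_def)
next
  case (insert i A)
  have step: "e (insert i A) k = e A k + r i * (case k of 0 \<Rightarrow> 0 | Suc m \<Rightarrow> e A m)" for k
    using insert.hyps by (cases k) (simp_all add: e_def)
  have two: "x + (x + y) = y" for x y :: "bit alg_closure"
    by (simp flip: add.assoc)
  have cube: "(x + y) ^ 3 = x ^ 3 + x ^ 2 * y + x * y ^ 2 + y ^ 3" for x y :: "bit alg_closure"
    using two by (simp add: power3_eq_cube power2_eq_square algebra_simps)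
  show ?case
    using insert two
    by (simp add: step numeral_2_eq_2 numeral_3_eq_3 cube[unfolded numeral_2_eq_2 numeral_3_eq_3] algebra_simps)
qed

lemma sum_square_split:
  fixes f :: "nat \<Rightarrow> nat \<Rightarrow> 'a :: comm_monoid_add"
  shows "(\<Sum>i<n. \<Sum>j<n. f i j) = (\<Sum>j<n. \<Sum>i<j. f i j + f j i) + (\<Sum>i<n. f i i)"
proof (induction n)
  case (Suc n)
  have "(\<Sum>i<Suc n. \<Sum>j<Suc n. f i j) =
    (\<Sum>i<n. \<Sum>j<n. f i j) + (\<Sum>i<n. f i n) + (\<Sum>j<n. f n j) + f n n"
    by (simp add: sum.distrib ac_simps)
  then show ?case
    by (simp add: Suc sum.distrib ac_simps)
qed simp

text \<open>
  Frobenius acts on the roots of an irreducible polynomial of even degree \<open>n\<close> as an odd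
  permutation, so the sum \<open>T\<close> of the \<open>t i j\<close> over \<open>i < j < n\<close> is not fixed: each of the
  \<open>n - 1\<close> pairs that wrap around contributes \<open>t i j + t j i = 1\<close>. On the other hand
  \<open>T\<^sup>2 + T\<close> can be read off from the sum of all \<open>(t i j)\<^sup>3\<close>. This is the
  characteristic-two form of Stickelberger's parity theorem.
\<close>

lemma stickelberger_parity:
  fixes g :: "nat \<Rightarrow> bit alg_closure"
  defines "t \<equiv> \<lambda>i j. g i / (g i + g j)"
  assumes frob: "\<And>i. g (Suc i) = g i ^ 2" and per: "g n = g 0"
    and inj: "inj_on g {..<n}" and n: "4 dvd n" "n > 0"
  shows "(\<Sum>j<n. t 0 j ^ 3) ^ 2 \<noteq> (\<Sum>j<n. t 0 j ^ 3)"
proof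
  define R where "R = (\<lambda>i. \<Sum>j<n. t i j ^ 3)"
  define T where "T = (\<Sum>j<n. \<Sum>i<j. t i j)"
  assume "(\<Sum>j<n. t 0 j ^ 3) ^ 2 = (\<Sum>j<n. t 0 j ^ 3)"
  then have R0: "R 0 ^ 2 = R 0" by (simp add: R_def)
  have t2: "t i j ^ 2 = t (Suc i) (Suc j)" for i j
    by (simp add: t_def frob ac_add_power2 power_divide)
  have t_self: "t i i = 0" for i by (simp add: t_def)
  have per_l: "t n j = t 0 j" and per_r: "t i n = t i 0" for i j
    by (simp_all add: t_def per)
  have compl: "t i j + t j i = 1" if "i < n" "j < n" "i \<noteq> j" for i j
  proof -
    have "g i \<noteq> g j" using that inj by (auto simp: inj_on_def)
    then have "g i + g j \<noteq> 0" by (simp add: ac_add_eq_0_iff)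
    then show ?thesis
      by (simp add: t_def add.commute[of "g j"] flip: add_divide_distrib)
  qed
  have "R (Suc i) = R i ^ 2" for i
  proof -
    have "R i ^ 2 = (\<Sum>j<n. t (Suc i) (Suc j) ^ 3)"
      by (simp add: R_def ac_sum_power2 flip: t2 power_mult)
    moreover have "t (Suc i) 0 ^ 3 + (\<Sum>j<n. t (Suc i) (Suc j) ^ 3) = R (Suc i) + t (Suc i) n ^ 3"
      using sum.lessThan_Suc_shift[of "\<lambda>j. t (Suc i) j ^ 3" n] sum.lessThan_Suc[of "\<lambda>j. t (Suc i) j ^ 3" n]
      unfolding R_def by metis
    ultimately show ?thesis by (simp add: per_r add.commute)
  qed
  \<comment> \<open>The row sums are conjugate under Frobenius, so they all equal the fixed element
    \<open>R 0\<close>, and an even number of them cancels.\<close>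
  then have "R i = R 0" for i
    using R0 by (induction i) simp_all
  then have "(\<Sum>i<n. R i) = (\<Sum>i<n. R 0)" by (intro sum.cong refl)
  then have "(\<Sum>i<n. R i) = 0"
    using n by (auto simp: ac_of_nat elim!: dvdE)
  moreover have "(\<Sum>i<n. R i) = (\<Sum>j<n. \<Sum>i<j. t i j ^ 3 + t j i ^ 3)"
    unfolding R_def by (subst sum_square_split) (simp add: t_self)
  moreover have "\<dots> = (\<Sum>j<n. \<Sum>i<j. 1 + (t i j + t i j ^ 2))"
  proof (intro sum.cong refl)
    fix i j assume "j \<in> {..<n}" "i \<in> {..<j}"
    then have "t j i = 1 + t i j"
      using compl[of i j] by (metis (no_types, lifting) ac_add_self add.commute add.left_commute add_0_right lessThan_iff less_trans less_irrefl)
    then have *: "t j i ^ 3 = (1 + t i j) ^ 3" by simp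
    have two: "x + (x + y) = y" for x y :: "bit alg_closure"
      by (simp flip: add.assoc)
    show "t i j ^ 3 + t j i ^ 3 = 1 + (t i j + t i j ^ 2)"
      unfolding * using two by (simp add: power3_eq_cube power2_eq_square algebra_simps)
  qed
  moreover have "\<dots> = of_nat (\<Sum>j<n. j) + (T + T ^ 2)"
    by (simp add: T_def sum.distrib ac_sum_power2)
  \<comment> \<open>The number \<open>n (n - 1) / 2\<close> of pairs is even because 4 divides
    \<open>n\<close>.\<close>
  moreover have "even (\<Sum>j<n. j)"
  proof -
    obtain k where k: "n = 4 * k" using n by blast
    have "2 * (\<Sum>j<n. j) = n * (n - 1)"
      by (induction n) (auto simp: algebra_simps le_square diff_mult_distrib2)
    then have "(\<Sum>j<n. j) = 2 * (k * (n - 1))" using k by simp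
    then show ?thesis by simp
  qed
  ultimately have "T + T ^ 2 = 0" by (simp add: ac_of_nat del: of_nat_sum)
  \<comment> \<open>Squaring shifts both indices by one: the pairs with \<open>i = 0\<close> are
    lost and the terms \<open>t i n = t i 0\<close> appear. Together these form \<open>n - 1\<close>
    complementary pairs, each of sum 1.\<close>
  moreover have "T ^ 2 = T + 1"
  proof -
    have "T ^ 2 = (\<Sum>j<n. \<Sum>i<j. t (Suc i) (Suc j))"
      by (simp add: T_def ac_sum_power2 t2)
    moreover have "(\<Sum>j<Suc n. \<Sum>i<j. t i j) = (\<Sum>j<n. \<Sum>i<Suc j. t i (Suc j))"
      by (subst sum.lessThan_Suc_shift) simp
    moreover have "\<dots> = (\<Sum>j<n. t 0 (Suc j)) + (\<Sum>j<n. \<Sum>i<j. t (Suc i) (Suc j))"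
      by (subst sum.distrib[symmetric], intro sum.cong refl) (subst sum.lessThan_Suc_shift, simp)
    moreover have "(\<Sum>j<Suc n. \<Sum>i<j. t i j) = T + (\<Sum>i<n. t i 0)"
      by (simp add: T_def per_r)
    ultimately have "T ^ 2 = T + ((\<Sum>i<n. t i 0) + (\<Sum>j<n. t 0 (Suc j)))"
      by (metis (no_types, lifting) ac_add_self add.assoc add.commute add_0_right)
    moreover have "(\<Sum>j<n. t 0 (Suc j)) = (\<Sum>j<n. t 0 j)"
      using sum.lessThan_Suc_shift[of "t 0" n] sum.lessThan_Suc[of "t 0" n] by (simp add: per_r t_self)
    moreover have "(\<Sum>i<n. t i 0) + (\<Sum>i<n. t 0 i) = (\<Sum>i<n. if i = 0 then 0 else 1)"
      unfolding sum.distrib[symmetric] using n by (intro sum.cong refl) (auto simp: t_self intro!: compl)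
    moreover have "\<dots> = of_nat (n - 1)"
    proof -
      have "{..<n} \<inter> - {0} = {1..<n}" by auto
      then show ?thesis by (simp add: sum.If_cases)
    qed
    moreover have "odd (n - 1)" using n by (auto elim!: dvdE)
    ultimately show ?thesis by (simp add: ac_of_nat)
  qed
  ultimately show False by (simp flip: add.assoc)
qed


text \<open>Equality modulo \<open>X^N\<close> is expressed throughout as divisibility of a
  difference by \<open>monom 1 N\<close>.\<close>

lemma coeff_eq_of_monom_dvd:
  assumes "monom 1 N dvd p - q" "j < N"
  shows "coeff p j = coeff (q :: 'a :: comm_ring_1 poly) j"
  using assms by (auto simp: monom_1_dvd_iff' elim!: allE[of _ j])

text \<open>The conjugates \<open>g i\<close> of \<open>y = x / (x + 1)\<close> are the roots of
  \<open>G = X^a + (X + 1)^n\<close>. Expanding \<open>G\<close> around \<open>y\<close> shows that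
  the low elementary symmetric functions of the \<open>y / (y + g i)\<close> are binomial
  coefficients, hence in the prime field, against \<open>stickelberger_parity\<close>.\<close>

lemma mersenne_degree_not_8:
  assumes irr: "irreducible (1 + polyX ^ a * (polyX + 1) ^ b)" and ab: "a > 0" "b > 0"
  shows "\<not> 8 dvd a + b"
proof
  assume dvd8: "8 dvd a + b"
  define f where "f = 1 + polyX ^ a * (polyX + 1) ^ b"
  define n where "n = a + b"
  have irr: "irreducible f" using irr by (simp add: f_def)
  have deg: "degree f = n" by (simp add: f_def n_def)
  have n0: "n > 0" using ab by (simp add: n_def)
  have odd: "odd a"
    using dvd8 mersenne_not_both_even[OF irr[unfolded f_def]]
    by (metis dvd_trans even_add even_numeral)
  obtain x where x: "ev f x = 0" using ex_ev_root[of f] n0 deg by auto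
  note xab = mersenne_root[OF x[unfolded f_def] ab]
  define y where "y = x / (x + 1)"
  define g where "g = (\<lambda>i::nat. y ^ (2 ^ i))"
  have y1: "1 + y = 1 / (x + 1)"
    using xab(3) by (simp add: y_def field_simps)
  have xy: "x = y / (1 + y)"
    using xab(3) unfolding y1 by (simp add: y_def)
  have y0: "y \<noteq> 0" using xab by (simp add: y_def)
  have eqn: "y ^ a = (1 + y) ^ n"
  proof -
    have "(1 + y) ^ n = x ^ a * (x + 1) ^ b / ((x + 1) ^ a * (x + 1) ^ b)"
      by (simp add: y1 n_def power_add power_divide xab(1))
    also have "\<dots> = y ^ a"
      using xab(3) by (simp add: y_def power_divide)
    finally show ?thesis by simp
  qed
  have "inj_on g {..<n}"
  proof (rule inj_onI)
    fix i j assume ij: "i \<in> {..<n}" "j \<in> {..<n}" "g i = g j"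
    have "x ^ (2 ^ k) = g k / (1 + g k)" for k
      by (subst xy) (simp add: g_def power_divide ac_add_power2_power)
    with ij(3) have "x ^ (2 ^ i) = x ^ (2 ^ j)" by simp
    then show "i = j" using frobenius_orbit(2)[OF irr x] ij deg by (auto simp: inj_on_def)
  qed
  have gS: "g (Suc i) = g i ^ 2" for i
    by (simp add: g_def mult.commute[of 2] power_mult)
  have gn: "g n = g 0"
    using frobenius_orbit(1)[OF irr x] deg by (simp add: g_def y_def power_divide ac_add_power2_power)
  have groot: "g i ^ a = (1 + g i) ^ n" for i
  proof -
    have "g i ^ a = (y ^ a) ^ (2 ^ i)" by (simp add: g_def mult.commute flip: power_mult)
    also have "\<dots> = ((1 + y) ^ (2 ^ i)) ^ n" by (simp add: eqn mult.commute flip: power_mult)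
    also have "\<dots> = (1 + g i) ^ n" by (simp add: g_def ac_add_power2_power)
    finally show ?thesis .
  qed
  define G where "G = [:0, 1:] ^ a + [:1, 1 :: bit alg_closure:] ^ n"
  have an: "a < n" using ab by (simp add: n_def)
  \<comment> \<open>Both sides are monic of degree \<open>n\<close>, as \<open>a < n\<close>, and
    vanish at the \<open>n\<close> distinct conjugates.\<close>
  have G_prod: "G = (\<Prod>i<n. [:g i, 1:])"
  proof (rule poly_eqI_degree_lead_coeff[of _ n _ "g ` {..<n}"])
    have d1: "degree ([:0, 1 :: bit alg_closure:] ^ a) = a" "degree ([:1, 1 :: bit alg_closure:] ^ n) = n"
      by (simp_all add: degree_power_eq)
    show "degree G \<le> n" unfolding G_def using d1 an by (intro degree_add_le) auto
    have d2: "degree (\<Prod>i<n. [:g i, 1:]) = n"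
      by (subst degree_prod_eq_sum_degree) auto
    then show "degree (\<Prod>i<n. [:g i, 1:]) \<le> n" by simp
    have "lead_coeff (\<Prod>i<n. [:g i, 1:]) = 1"
      by (simp add: lead_coeff_prod)
    moreover have "coeff G n = 1"
      using an d1 by (simp add: G_def coeff_eq_0 coeff_linear_poly_power)
    ultimately show "coeff G n = coeff (\<Prod>i<n. [:g i, 1:]) n" using d2 by simp
    show "card (g ` {..<n}) \<ge> n" using \<open>inj_on g {..<n}\<close> by (simp add: card_image)
    show "poly G z = poly (\<Prod>i<n. [:g i, 1:]) z" if "z \<in> g ` {..<n}" for z
    proof -
      from that obtain i where i: "z = g i" "i < n" by auto
      then have "poly (\<Prod>i<n. [:g i, 1:]) z = 0"
        by (auto simp: poly_prod prod_zero_iff intro!: bexI[of _ i])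
      moreover have "poly G z = 0"
        using groot[of i] i by (simp add: G_def add.commute)
      ultimately show ?thesis by simp
    qed
  qed
  define t where "t = (\<lambda>i. y / (y + g i))"
  define E where "E = (\<Prod>i\<in>{1..<n}. [:1, t i:])"
  define K where "K = (\<Prod>i\<in>{1..<n}. y + g i)"
  \<comment> \<open>This is \<open>G(y + y X)\<close>: the factor of \<open>g 0 = y\<close> becomes
    \<open>y X\<close>, and the one of \<open>g i\<close> with \<open>i > 0\<close> becomes
    \<open>(y + g i) (1 + t i X)\<close>.\<close>
  define H where "H = pcompose G [:y, y:]"
  \<comment> \<open>As 8 divides \<open>n\<close>, \<open>(1 + y + y X)^n\<close> is a polynomial in
    \<open>X^8\<close>, so only \<open>(y + y X)^a\<close> contributes in degrees 1 to 7.\<close>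
  have H1: "coeff H j = y ^ a * of_nat (a choose j)" if "0 < j" "j < 8" for j
  proof -
    obtain k where k: "n = 8 * k" using dvd8 by (auto simp: n_def)
    have "[:1 + y, y:] ^ 8 = (([:1 + y, y:] ^ 2) ^ 2) ^ 2" by (simp flip: power_mult)
    also have "[:1 + y, y:] ^ 2 = [:(1 + y) ^ 2, 0, y ^ 2:]"
      by (simp add: power2_eq_square)
    also have "\<dots> ^ 2 = [:(1 + y) ^ 4, 0, 0, 0, y ^ 4:]"
      by (simp add: power2_eq_square power4_eq_xxxx mult.assoc)
    also have "\<dots> ^ 2 = [:((1 + y) ^ 4)\<^sup>2, 0, 0, 0, 0, 0, 0, 0, (y ^ 4)\<^sup>2:]"
      by (simp add: power2_eq_square)
    finally have "[:1 + y, y:] ^ 8 - [:((1 + y) ^ 4)\<^sup>2:] = monom ((y ^ 4)\<^sup>2) 8"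
      by (simp add: monom_Suc numeral_eq_Suc monom_0)
    then have "monom 1 8 dvd [:1 + y, y:] ^ 8 - [:((1 + y) ^ 4)\<^sup>2:]"
      by (simp add: monom_1_dvd_iff')
    also have "\<dots> dvd ([:1 + y, y:] ^ 8) ^ k - [:((1 + y) ^ 4)\<^sup>2:] ^ k"
      by (simp add: power_diff_sumr2)
    finally have "coeff (([:1 + y, y:] ^ 8) ^ k) j = coeff ([:((1 + y) ^ 4)\<^sup>2:] ^ k) j"
      using that by (intro coeff_eq_of_monom_dvd)
    also have "\<dots> = 0"
      using that by (simp add: poly_const_pow coeff_pCons split: nat.split)
    finally have "coeff ([:1 + y, y:] ^ n) j = 0" by (simp add: k power_mult)
    moreover have "coeff ([:0 + y, y:] ^ a) j = y ^ a * of_nat (a choose j)"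
    proof (cases "j \<le> a")
      case True
      then show ?thesis by (simp add: coeff_linear_poly_power flip: power_add)
    next
      case False
      have "degree ([:0 + y, y:] ^ a) < j" using False y0 by (simp add: degree_power_eq)
      then show ?thesis using False by (simp add: coeff_eq_0 binomial_eq_0)
    qed
    moreover have "pcompose (q ^ k) r = pcompose q r ^ k" for q r :: "bit alg_closure poly" and k
      by (induction k) (simp_all add: pcompose_mult pcompose_1)
    then have "H = [:0 + y, y:] ^ a + [:1 + y, y:] ^ n"
      by (simp add: H_def G_def pcompose_add pcompose_pCons)
    ultimately show ?thesis by simp
  qed
  have "H = (\<Prod>i<n. [:y + g i, y:])"
    by (simp add: H_def G_prod pcompose_prod pcompose_pCons add.commute)
  also have "\<dots> = [:y + g 0, y:] * (\<Prod>i\<in>{1..<n}. [:y + g i, y:])"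
    using n0 by (simp add: lessThan_atLeast0 prod.atLeast_Suc_lessThan)
  also have "(\<Prod>i\<in>{1..<n}. [:y + g i, y:]) = (\<Prod>i\<in>{1..<n}. [:y + g i:] * [:1, t i:])"
  proof (intro prod.cong refl)
    fix i assume "i \<in> {1..<n}"
    then have "g 0 \<noteq> g i" using \<open>inj_on g {..<n}\<close> by (auto simp: inj_on_def)
    then have "y + g i \<noteq> 0" by (simp add: g_def ac_add_eq_0_iff)
    then show "[:y + g i, y:] = [:y + g i:] * [:1, t i:]" by (simp add: t_def)
  qed
  also have "\<dots> = [:K:] * E"
  proof -
    have "(\<Prod>i\<in>A. [:f i:]) = [:\<Prod>i\<in>A. f i:]" for A :: "nat set" and f :: "nat \<Rightarrow> bit alg_closure"
      by (induction A rule: infinite_finite_induct) (simp_all add: one_pCons)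
    then show ?thesis by (simp only: prod.distrib K_def E_def)
  qed
  finally have H2: "coeff H (Suc k) = y * K * coeff E k" for k
    by (simp add: g_def)
  have sum3: "(\<Sum>i\<in>{1..<n}. t i ^ 3) = coeff E 1 ^ 3 + coeff E 1 * coeff E 2 + coeff E 3"
    and E0: "coeff E 0 = 1"
    using sum_cubes_elementary_symmetric[of "{1..<n}" t] by (simp_all add: E_def)
  \<comment> \<open>The linear coefficient of \<open>H\<close> is \<open>a y^a\<close>, and
    \<open>a\<close> is odd.\<close>
  have yK: "y * K = y ^ a"
    using H1[of 1] H2[of 0] E0 odd by (simp add: ac_of_nat)
  have E: "coeff E k = of_nat (a choose Suc k)" if "k < 7" for k
    using H1[of "Suc k"] H2[of k] that y0 by (simp add: yK)
  have E': "coeff E 1 = of_nat (a choose 2)" "coeff E 2 = of_nat (a choose 3)"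
    "coeff E 3 = of_nat (a choose 4)"
    using E[of 1] E[of 2] E[of 3] by (simp_all add: eval_nat_numeral)
  define s where "s = (\<Sum>j<n. (g 0 / (g 0 + g j)) ^ 3)"
  have "s = (g 0 / (g 0 + g 0)) ^ 3 + (\<Sum>i\<in>{1..<n}. t i ^ 3)"
    using n0 by (simp add: s_def t_def g_def lessThan_atLeast0 sum.atLeast_Suc_lessThan)
  also have "\<dots> = of_nat ((a choose 2) ^ 3 + (a choose 2) * (a choose 3) + (a choose 4))"
    unfolding sum3 E' by simp
  finally have "s ^ 2 = s" by (simp add: ac_of_nat del: of_nat_add)
  moreover have "s ^ 2 \<noteq> s"
    unfolding s_def using gS gn \<open>inj_on g {..<n}\<close> n0 dvd8
    by (intro stickelberger_parity) (auto simp: n_def intro: dvd_trans[of 4 8])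
  ultimately show False by simp
qed

section \<open>Geometric sums\<close>

lemma irreducible_dvd_mult:
  fixes P :: "bit poly"
  assumes "irreducible P" "P dvd A * B"
  shows "P dvd A \<or> P dvd B"
proof -
  obtain x where x: "ev P x = 0" using ex_ev_root irreducible_degree_pos[OF assms(1)] by blast
  then have "ev A x * ev B x = 0" using assms(2) by (metis dvdE ev_mult mult_zero_left)
  then show ?thesis using irreducible_ev_dvd[OF assms(1) x] by auto
qed

lemma irreducible_dvd_irreducible:
  fixes P :: "bit poly"
  assumes "irreducible P" "irreducible Q" "P dvd Q"
  shows "P = Q"
proof -
  obtain R where R: "Q = P * R" using assms(3) by blast
  have "\<not> P dvd 1" using assms(1) by (auto simp: Factorial_Ring.irreducible_def)
  then have "R dvd 1" using Factorial_Ring.irreducibleD[OF assms(2) R] by blast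
  then show ?thesis using R by (simp add: bit_poly_is_unit_iff)
qed

lemma dvd_irreducible_power:
  fixes M :: "bit poly"
  assumes M: "irreducible M" and "D dvd M ^ k"
  shows "\<exists>i\<le>k. D = M ^ i"
  using assms(2)
proof (induction k arbitrary: D)
  case 0
  then show ?case by (simp add: bit_poly_is_unit_iff)
next
  case (Suc k)
  have M0: "M \<noteq> 0" using M by auto
  obtain E where E: "M ^ Suc k = D * E" using Suc.prems by blast
  then have "M dvd D * E" by (metis dvd_triv_left power_Suc)
  then consider A where "D = M * A" | A where "E = M * A"
    using irreducible_dvd_mult[OF M] by blast
  then show ?case
  proof cases
    case 1
    then have "M ^ k = A * E" using E M0 by simp
    then obtain i where "i \<le> k" "A = M ^ i" using Suc.IH[of A] by (metis dvd_triv_left)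
    then show ?thesis using 1 by (intro exI[of _ "Suc i"]) simp
  next
    case 2
    then have "M ^ k = D * A" using E M0 by simp
    then obtain i where "i \<le> k" "D = M ^ i" using Suc.IH[of D] by (metis dvd_triv_left)
    then show ?thesis by (intro exI[of _ i]) simp
  qed
qed

lemma sigma_poly_irreducible_power:
  assumes M: "irreducible M"
  shows "sigma_poly (M ^ k) = (\<Sum>i<Suc k. M ^ i)"
proof -
  have "{D. D dvd M ^ k} = (^) M ` {..<Suc k}"
    by (auto simp: less_Suc_eq_le le_imp_power_dvd dest!: dvd_irreducible_power[OF M])
  moreover have "inj ((^) M)"
  proof (rule injI)
    fix i j assume "M ^ i = M ^ j"
    then have "i * degree M = j * degree M" using M by (metis degree_power_eq Factorial_Ring.irreducible_def)
    then show "i = j" using irreducible_degree_pos[OF M] by simp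
  qed
  ultimately show ?thesis
    unfolding sigma_poly_def by (simp add: sum.reindex inj_on_subset)
qed

lemma geometric_dvd_geometric:
  fixes M :: "bit poly"
  assumes "M \<noteq> 1" "q dvd N"
  shows "(\<Sum>i<q. M ^ i) dvd (\<Sum>i<N. M ^ i)"
proof -
  obtain k where k: "N = q * k" using assms(2) by blast
  have "(M - 1) * (\<Sum>i<N. M ^ i) = M ^ N - 1"
    by (simp only: power_diff_1_eq)
  also have "\<dots> = (M ^ q) ^ k - 1" by (simp only: k power_mult)
  also have "\<dots> = (M ^ q - 1) * (\<Sum>i<k. (M ^ q) ^ i)"
    by (simp only: power_diff_1_eq)
  also have "\<dots> = (M - 1) * ((\<Sum>i<q. M ^ i) * (\<Sum>i<k. (M ^ q) ^ i))"
    by (simp only: power_diff_1_eq[of M] mult.assoc)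
  finally have "(M - 1) * (\<Sum>i<N. M ^ i) = (M - 1) * ((\<Sum>i<q. M ^ i) * (\<Sum>i<k. (M ^ q) ^ i))" .
  moreover have "M - 1 \<noteq> 0" using assms by (simp only: right_minus_eq not_False_eq_True)
  ultimately have "(\<Sum>i<N. M ^ i) = (\<Sum>i<q. M ^ i) * (\<Sum>i<k. (M ^ q) ^ i)"
    by (simp only: mult_cancel_left) simp
  then show ?thesis by simp
qed

lemma degree_geometric:
  fixes M :: "bit poly"
  assumes "degree M > 0"
  shows "degree (\<Sum>i<Suc k. M ^ i) = k * degree M"
proof (induction k)
  case (Suc k)
  have "M \<noteq> 0" using assms by auto
  then have "degree (M ^ Suc k) = Suc k * degree M" by (rule degree_power_eq)
  moreover have "degree ((\<Sum>i<Suc k. M ^ i) + M ^ Suc k) = degree (M ^ Suc k)"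
    using Suc assms calculation by (intro degree_add_eq_right) simp
  ultimately show ?case by simp
qed simp

lemma order_8_factor:
  assumes M: "degree M > 0" and p: "prime p" "p \<noteq> 2" "8 dvd ord p 2"
  shows "\<exists>P. irreducible P \<and> \<not> mersenne_prime_poly P \<and> P dvd (\<Sum>i<p. M ^ i)"
proof -
  have "p \<ge> 3" using p prime_ge_2_nat[of p] by simp
  then have "degree (\<Sum>i<p. M ^ i) > 0"
    using degree_geometric[OF M, of "p - 1"] M by simp
  then obtain P where P: "irreducible P" "P dvd (\<Sum>i<p. M ^ i)"
    by (rule ex_irreducible_factor)
  have "odd p" using p prime_odd_nat \<open>p \<ge> 3\<close> by auto
  then have "p dvd 2 ^ degree P - 1"
    using geometric_factor_degree[OF P] p(1) prime_imp_coprime by blast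
  then have "[2 ^ degree P = 1] (mod p)"
    by (subst cong_altdef_nat) simp_all
  then have "ord p 2 dvd degree P" using ord_divides by blast
  then have "8 dvd degree P" using p(3) dvd_trans by blast
  then have "\<not> mersenne_prime_poly P"
    using mersenne_degree_not_8 by (auto simp: mersenne_prime_poly_def)
  then show ?thesis using P by blast
qed

section \<open>Exponents that are Mersenne numbers\<close>

lemma card_roots_of_unity:
  assumes "odd p"
  shows "card {z :: bit alg_closure. z ^ p = 1} = p"
proof -
  define F :: "bit alg_closure poly" where "F = monom 1 p - 1"
  have p0: "p > 0" using assms by (rule odd_pos)
  have deg: "degree F = p"
    unfolding F_def diff_conv_add_uminus using p0
    by (subst degree_add_eq_left) (simp_all add: degree_monom_eq)
  then have "F \<noteq> 0" using p0 by auto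
  then obtain A where A: "size A = p" "F = Polynomial.smult (lead_coeff F) (\<Prod>x\<in>#A. [:-x, 1:])"
    using alg_closed_imp_factorization deg by metis
  have "lead_coeff F = 1"
    unfolding deg using p0 by (simp add: F_def)
  then have F: "F = (\<Prod>x\<in>#A. [:-x, 1:])" using A by simp
  have polyF: "poly F z = 0 \<longleftrightarrow> z ^ p = 1" for z
    by (simp add: F_def poly_monom)
  have roots: "z \<in># A \<longleftrightarrow> z ^ p = 1" for z
    unfolding polyF[symmetric] by (simp add: F poly_prod_mset prod_mset_zero_iff image_iff)
       (metis ac_add_eq_0_iff)
  \<comment> \<open>A repeated root would be a root of the derivative \<open>p X^(p - 1)\<close>,
    whose only zero is 0 as \<open>p\<close> is odd.\<close>
  have "count A z = 1" if "z \<in># A" for z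
  proof (rule ccontr)
    assume "count A z \<noteq> 1"
    then have "count A z \<ge> 2" using that by (metis One_nat_def Suc_1 Suc_leI count_greater_zero_iff le_neq_implies_less)
    then have "{#z, z#} \<subseteq># A" by (simp add: subseteq_mset_def)
    then obtain B where "A = add_mset z (add_mset z B)"
      by (metis add_mset_add_single mset_subset_eq_exists_conv union_mset_add_mset_left add_0 empty_neutral(1))
    then have "F = [:-z, 1:] * ([:-z, 1:] * (\<Prod>x\<in>#B. [:-x, 1:]))" using F by simp
    then have "poly (pderiv F) z = 0" by (simp add: pderiv_mult del: mult_pCons_left)
    moreover have "pderiv F = monom (of_nat p) (p - 1)"
      by (simp add: F_def pderiv_diff pderiv_monom)
    ultimately have "z = 0" using assms by (auto simp: poly_monom ac_of_nat)
    then show False using that roots[of z] p0 by (simp add: power_0_left)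
  qed
  then have "A = mset_set (set_mset A)" by (intro multiset_eqI) (auto simp: count_mset_set' not_in_iff)
  then have "card (set_mset A) = p" using A(1) by (metis size_mset_set)
  moreover have "set_mset A = {z. z ^ p = 1}" using roots by auto
  ultimately show ?thesis by simp
qed

text \<open>Compares the at most \<open>m (m - 1)\<close> roots of the \<open>m - 1\<close> Mersenne
  polynomials of degree \<open>m\<close> with the \<open>2^m - 2\<close> elements other than 0 and 1
  of the field with \<open>2^m\<close> elements.\<close>

lemma mersenne_count:
  assumes "5 \<le> (m :: nat)"
  shows "m * (m - 1) + 2 < 2 ^ m"
  using assms
proof (induction m rule: dec_induct)
  case (step m)
  have "Suc m * (Suc m - 1) + 2 = m * (m - 1) + 2 + 2 * m"
    using step.hyps by (cases m) (simp_all add: algebra_simps)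
  also have "2 * m \<le> m * (m - 1)" using step.hyps by (subst mult.commute) (intro mult_le_mono2, simp)
  finally show ?case using step.IH by simp
qed simp

text \<open>By counting, some \<open>z\<close> other than 0 and 1 in the field with
  \<open>2^m\<close> elements is a root of no Mersenne polynomial of degree \<open>m\<close>. Its
  minimal polynomial \<open>P\<close> has degree \<open>m\<close>, so it is not Mersenne, and the
  value of \<open>M\<close> at \<open>z\<close> is a \<open>p\<close>-th root of unity other than
  1.\<close>

lemma mersenne_number_factor:
  assumes M: "mersenne_prime_poly M" and m: "m \<ge> 5" "prime (2 ^ m - 1 :: nat)"
  shows "\<exists>P. irreducible P \<and> \<not> mersenne_prime_poly P \<and> P dvd (\<Sum>i<2 ^ m - 1. M ^ i)"
proof -
  define p :: nat where "p = 2 ^ m - 1"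
  have p: "prime p" using m by (simp add: p_def)
  have "(2::nat) ^ m \<ge> 2 ^ 5" using m by (intro power_increasing) auto
  then have p31: "p \<ge> 31" "2 ^ m = Suc p" by (simp_all add: p_def)
  then have odd: "odd p" using m by (metis even_Suc even_power gr0I not_numeral_le_zero even_numeral)
  define Z where "Z = {z :: bit alg_closure. z ^ p = 1} - {1}"
  have cardZ: "card Z = p - 1"
    unfolding Z_def by (subst card_Diff_singleton) (simp_all add: card_roots_of_unity[OF odd])
  have Zm: "z ^ (2 ^ m) = z" if "z \<in> Z" for z
    using that p31 by (simp add: Z_def)
  \<comment> \<open>The order of \<open>z\<close> is the prime \<open>p\<close>, so \<open>p\<close>
    divides \<open>2^degree P - 1\<close> and \<open>degree P\<close> is at least \<open>m\<close>;
    the return of \<open>z\<close> to itself after \<open>m\<close> Frobenius steps gives the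
    reverse bound.\<close>
  have min: "\<exists>P. irreducible P \<and> degree P = m \<and> ev P z = 0" if z: "z \<in> Z" for z
  proof -
    obtain V where "V \<noteq> 0" "ev V z = 0"
      using alg_closure_algebraic[of z] unfolding ev_def by blast
    then obtain P where P: "irreducible P" "ev P z = 0"
      using ex_irreducible_root_factor by blast
    have z1: "z ^ p = 1" "z \<noteq> 1" using z by (auto simp: Z_def)
    then have z0: "z \<noteq> 0" using p31 by (auto simp: power_0_left)
    have "z * z ^ (2 ^ degree P - 1) = z * 1"
      using frobenius_orbit(1)[OF P] by (simp flip: power_Suc)
    then have "z ^ (2 ^ degree P - 1) = 1" using z0 by (metis mult_cancel_left)
    then have "\<not> coprime p (2 ^ degree P - 1)"
      using power_eq_1_coprime[of z p] z1 p31 by auto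
    then have "p dvd 2 ^ degree P - 1" using p prime_imp_coprime by blast
    then have "p \<le> 2 ^ degree P - 1"
      using one_less_power[of "2 :: nat" "degree P"] irreducible_degree_pos[OF P(1)]
      by (intro dvd_imp_le) auto
    then have "(2::nat) ^ m \<le> 2 ^ degree P" using p31 by simp
    then have "m \<le> degree P" by simp
    moreover have "\<not> m < degree P"
    proof
      assume "m < degree P"
      then have "m = 0"
        using frobenius_orbit(2)[OF P] Zm[OF z] inj_onD[of "\<lambda>i. z ^ 2 ^ i" _ m 0] by fastforce
      then show False using m by simp
    qed
    ultimately show ?thesis using P by auto
  qed
  define F where "F = (\<lambda>a. 1 + polyX ^ a * (polyX + 1) ^ (m - a))"
  have "\<not> Z \<subseteq> (\<Union>a\<in>{1..<m}. {z. ev (F a) z = 0})"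
  proof
    assume sub: "Z \<subseteq> (\<Union>a\<in>{1..<m}. {z. ev (F a) z = 0})"
    have F0: "F a \<noteq> 0" "degree (F a) = m" if "a \<in> {1..<m}" for a
    proof -
      show "degree (F a) = m" using that by (simp add: F_def)
      then show "F a \<noteq> 0" using m by auto
    qed
    have "card Z \<le> card (\<Union>a\<in>{1..<m}. {z. ev (F a) z = 0})"
      using F0 finite_ev_roots by (intro card_mono[OF _ sub]) auto
    also have "\<dots> \<le> (\<Sum>a\<in>{1..<m}. card {z. ev (F a) z = 0})"
      by (intro card_UN_le) simp
    also have "\<dots> \<le> (\<Sum>a\<in>{1..<m}. m)"
      using F0 finite_ev_roots by (intro sum_mono) fastforce
    also have "\<dots> = m * (m - 1)" by simp
    finally show False using cardZ p31 mersenne_count[OF m(1)] by linarith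
  qed
  then obtain z where z: "z \<in> Z" and nz: "\<And>a. a \<in> {1..<m} \<Longrightarrow> ev (F a) z \<noteq> 0" by blast
  obtain P where P: "irreducible P" "degree P = m" "ev P z = 0" using min[OF z] by blast
  have notM: "\<not> mersenne_prime_poly P"
  proof
    assume "mersenne_prime_poly P"
    then obtain c d where cd: "c > 0" "d > 0" "P = 1 + polyX ^ c * (polyX + 1) ^ d"
      by (auto simp: mersenne_prime_poly_def)
    then have "m = c + d" using P(2) by simp
    then have "F c = P" "c \<in> {1..<m}" using cd by (auto simp: F_def)
    then show False using nz P(3) by blast
  qed
  obtain a b where ab: "a > 0" "b > 0" "M = 1 + polyX ^ a * (polyX + 1) ^ b"
    using M by (auto simp: mersenne_prime_poly_def)
  have irr: "irreducible M" using M by (simp add: mersenne_prime_poly_def)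
  have "z \<noteq> 0" "z + 1 \<noteq> 0"
    using z p31 by (auto simp: Z_def power_0_left ac_add_eq_0_iff)
  then have M1: "ev M z \<noteq> 1" by (simp add: ab add.commute)
  have M0: "ev M z \<noteq> 0"
  proof
    assume "ev M z = 0"
    then have "P dvd M" using irreducible_ev_dvd P by blast
    then have "P = M" using irreducible_dvd_irreducible P irr by blast
    then show False using M notM by simp
  qed
  have "ev M z ^ (2 ^ m) = ev M z" using Zm[OF z] by (metis ev_power2_power)
  then have "ev M z * ev M z ^ p = ev M z * 1" using p31 by simp
  then have "ev M z ^ p = 1" using M0 by (metis mult_cancel_left)
  then have "(ev M z - 1) * (\<Sum>i<p. ev M z ^ i) = 0"
    using power_diff_1_eq[of "ev M z" p] by simp
  then have "(\<Sum>i<p. ev M z ^ i) = 0" using M1 by (simp only: mult_eq_0_iff right_minus_eq) simp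
  then have "ev (\<Sum>i<p. M ^ i) z = 0" by (simp add: ev_sum)
  then have "P dvd (\<Sum>i<p. M ^ i)" using irreducible_ev_dvd P by blast
  then show ?thesis using P notM by (auto simp: p_def)
qed

section \<open>Leading coefficients\<close>

lemma reflect_poly_add:
  fixes p q :: "'a :: comm_ring_1 poly"
  assumes "degree q < degree p"
  shows "reflect_poly (p + q) = reflect_poly p + monom 1 (degree p - degree q) * reflect_poly q"
proof (rule poly_eqI)
  fix k
  have "degree (p + q) = degree p" using assms by (rule degree_add_eq_left)
  then show "coeff (reflect_poly (p + q)) k =
      coeff (reflect_poly p + monom 1 (degree p - degree q) * reflect_poly q) k"
    using assms by (auto simp: coeff_reflect_poly coeff_monom_mult coeff_eq_0)
qed

lemma reflect_mersenne:
  assumes "a + b > 0"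
  shows "reflect_poly (1 + polyX ^ a * (polyX + 1) ^ b) = [:1, 1:] ^ b + monom 1 (a + b)"
proof -
  have deg: "degree (polyX ^ a * (polyX + 1) ^ b) = a + b"
    by (simp add: degree_mult_eq degree_power_eq one_pCons)
  have X: "reflect_poly polyX = 1"
    by (simp add: reflect_poly_def one_pCons)
  have Y: "reflect_poly (polyX + 1) = [:1, 1:]"
    by (simp add: reflect_poly_def one_pCons cCons_def)
  have "reflect_poly (polyX ^ a * (polyX + 1) ^ b + 1) = [:1, 1:] ^ b + monom 1 (a + b)"
    using assms by (subst reflect_poly_add) (simp_all add: deg reflect_poly_mult reflect_poly_power X Y)
  then show ?thesis by (simp only: add.commute)
qed

text \<open>With \<open>R = reflect_poly M\<close> and \<open>n = degree M\<close>, the reversed sum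
  is \<open>R^(k+1) + z^n R^k + z^(2n) R^(k-1) + ...\<close>; the first two terms determine it below
  order \<open>2n\<close>.\<close>

lemma reflect_geometric:
  fixes M :: "bit poly"
  assumes n: "degree M > 0"
  shows "monom 1 (2 * degree M) dvd
    reflect_poly (\<Sum>i<Suc (Suc k). M ^ i) - (reflect_poly M ^ Suc k + monom 1 (degree M) * reflect_poly M ^ k)"
proof -
  have step: "reflect_poly (\<Sum>i<Suc (Suc k). M ^ i) =
      reflect_poly M ^ Suc k + monom 1 (degree M) * reflect_poly (\<Sum>i<Suc k. M ^ i)" for k
  proof -
    have d: "degree (M ^ Suc k) = Suc k * degree M"
      using n by (intro degree_power_eq) auto
    then have "degree (\<Sum>i<Suc k. M ^ i) < degree (M ^ Suc k)"
      using n by (simp only: degree_geometric[OF n]) simp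
    then have "reflect_poly (M ^ Suc k + (\<Sum>i<Suc k. M ^ i)) =
      reflect_poly (M ^ Suc k) + monom 1 (degree M) * reflect_poly (\<Sum>i<Suc k. M ^ i)"
      by (subst reflect_poly_add) (simp_all only: d degree_geometric[OF n], simp)
    then show ?thesis
      by (simp only: reflect_poly_power sum.lessThan_Suc add.commute)
  qed
  define z :: "bit poly" where "z = monom 1 (degree M)"
  have zz: "monom 1 (2 * degree M) = z * z" by (simp add: z_def mult_monom mult_2)
  show ?thesis
  proof (cases k)
    case 0
    then show ?thesis by (simp only: step) (simp flip: z_def)
  next
    case (Suc l)
    define R where "R = reflect_poly M"
    have "reflect_poly (\<Sum>i<Suc (Suc k). M ^ i) - (R ^ Suc k + z * R ^ k) =
      z * z * reflect_poly (\<Sum>i<Suc l. M ^ i)"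
      unfolding step Suc step[of l] R_def[symmetric] z_def[symmetric] by (simp only: algebra_simps)
    then show ?thesis unfolding zz R_def z_def[symmetric] by (metis dvd_triv_left)
  qed
qed

lemma bit_of_nat: "of_nat n = (if even n then 0 else 1 :: bit)"
  by (induction n) auto

text \<open>The derivative of a square vanishes in characteristic two, and it retains all
  coefficients of odd index.\<close>

lemma coeff_square_odd:
  fixes p :: "bit poly"
  assumes "odd k"
  shows "coeff (p ^ 2) k = 0"
proof -
  obtain j where j: "k = Suc j" "even j" using assms by (cases k) auto
  have "pderiv (p ^ 2) = 0" by (simp add: power2_eq_square pderiv_mult mult.commute)
  then have "of_nat (Suc j) * coeff (p ^ 2) (Suc j) = 0"
    by (metis coeff_pderiv coeff_0)
  moreover have "of_nat (Suc j) = (1 :: bit)" using j(2) by (simp only: bit_of_nat) simp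
  ultimately show ?thesis using j by simp
qed

text \<open>
  A Mersenne polynomial \<open>1 + x\<^sup>a (x + 1)\<^sup>b\<close> agrees with \<open>x\<^sup>a (x + 1)\<^sup>b\<close> in its leading
  \<open>a + b\<close> coefficients, so in the reciprocal variable a product of such polynomials of degree
  at least \<open>N\<close> is a power of \<open>1 + z\<close> modulo \<open>z\<^sup>N\<close>.
\<close>

lemma reflect_product_of_mersenne:
  assumes "V \<noteq> 0"
    and "\<And>P. irreducible P \<Longrightarrow> P dvd V \<Longrightarrow> mersenne_prime_poly P \<and> N \<le> degree P"
  shows "\<exists>v. monom 1 N dvd reflect_poly V - [:1, 1:] ^ v"
  using assms
proof (induction "degree V" arbitrary: V rule: less_induct)
  case less
  show ?case
  proof (cases "degree V = 0")
    case True
    then have "V = 1" using less.prems bit_poly_degree_0 by blast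
    then show ?thesis by (intro exI[of _ 0]) simp
  next
    case False
    then obtain P where P: "irreducible P" "P dvd V" using ex_irreducible_factor by blast
    then obtain U where U: "V = P * U" by blast
    have nz: "P \<noteq> 0" "U \<noteq> 0" using U less.prems(1) by auto
    have "degree U < degree V"
      using irreducible_degree_pos[OF P(1)] nz by (simp add: U degree_mult_eq)
    moreover have "mersenne_prime_poly Q \<and> N \<le> degree Q" if "irreducible Q" "Q dvd U" for Q
      using less.prems(2)[of Q] that U by simp
    ultimately obtain v where v: "monom 1 N dvd reflect_poly U - [:1, 1:] ^ v"
      using less.hyps[of U] nz by blast
    obtain a b where ab: "a > 0" "P = 1 + polyX ^ a * (polyX + 1) ^ b"
      using less.prems(2)[OF P] by (auto simp: mersenne_prime_poly_def)
    have "N \<le> a + b" using less.prems(2)[OF P] ab(2) by simp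
    have rP: "reflect_poly P = [:1, 1:] ^ b + monom 1 (a + b)"
      using reflect_mersenne ab by simp
    have "monom 1 N dvd (monom 1 (a + b) :: bit poly)"
      using \<open>N \<le> a + b\<close> by (simp add: monom_1_dvd_iff')
    then have "monom 1 N dvd monom 1 (a + b) * reflect_poly U + [:1, 1:] ^ b * (reflect_poly U - [:1, 1:] ^ v)"
      using v by (intro dvd_add dvd_mult dvd_mult2)
    also have "\<dots> = reflect_poly V - [:1, 1:] ^ (b + v)"
      unfolding U reflect_poly_mult rP power_add by (simp only: algebra_simps)
    finally show ?thesis by blast
  qed
qed

lemma linear_power_coeff_1: "coeff ([:1, 1:] ^ v :: bit poly) 1 = of_nat v"
proof (cases "v = 0")
  case False
  then show ?thesis by (subst coeff_linear_poly_power) simp_all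
qed simp

lemma coeff_mult_1: "coeff (p * q) 1 = coeff p 0 * coeff q 1 + coeff p 1 * coeff q 0"
  by (simp add: coeff_mult)

text \<open>Otherwise the reversed sum is \<open>(1 + z)^v\<close> modulo \<open>z^N\<close>. Since
  \<open>q - 1\<close> is even, \<open>R^(q-1)\<close> is a square without odd coefficients; the
  coefficient of \<open>z\<close> then makes \<open>v\<close> even, so \<open>(1 + z)^v\<close> has
  no odd coefficients either. The term \<open>z^n R^(q-2)\<close> contradicts this at the first odd
  index from \<open>n\<close> on.\<close>

lemma large_degree_factor:
  assumes irr: "irreducible M" and M: "M = 1 + polyX ^ a * (polyX + 1) ^ b" "a + b \<ge> 2"
    and q: "odd q" "q \<ge> 3"
    and deg: "\<And>P. irreducible P \<Longrightarrow> P dvd (\<Sum>i<q. M ^ i) \<Longrightarrow>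
                (if odd (a + b) then a + b + 1 else a + b + 2) \<le> degree P"
  shows "\<exists>P. irreducible P \<and> \<not> mersenne_prime_poly P \<and> P dvd (\<Sum>i<q. M ^ i)"
proof (rule ccontr)
  assume contra: "\<not> ?thesis"
  define n where "n = a + b"
  define N where "N = (if odd n then n + 1 else n + 2)"
  \<comment> \<open>The least odd index not below \<open>n\<close>; the precision
    \<open>N = j + 1\<close> just reaches it.\<close>
  define j where "j = (if odd n then n else n + 1)"
  define V where "V = (\<Sum>i<q. M ^ i)"
  obtain l where l: "q = Suc (Suc (2 * l + 1))"
  proof -
    from q obtain r where r: "q = 2 * r + 1" by (auto elim!: oddE)
    with q(2) have "q = Suc (Suc (2 * (r - 1) + 1))" by simp
    then show ?thesis using that by blast
  qed
  have degM: "degree M = n" by (simp add: M n_def)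
  have n2: "n \<ge> 2" using M by (simp add: n_def)
  have "degree V = (q - 1) * n"
    using degree_geometric[of M "q - 1"] n2 q by (simp add: V_def degM)
  then have "V \<noteq> 0" using n2 q by auto
  moreover have "mersenne_prime_poly P \<and> N \<le> degree P" if "irreducible P" "P dvd V" for P
    using that contra deg[of P] by (auto simp: V_def N_def n_def)
  ultimately obtain v where v: "monom 1 N dvd reflect_poly V - [:1, 1:] ^ v"
    using reflect_product_of_mersenne[of V N] by blast
  define R where "R = reflect_poly M"
  have "monom 1 (2 * n) dvd reflect_poly V - (R ^ Suc (2 * l + 1) + monom 1 n * R ^ (2 * l + 1))"
    using reflect_geometric[of M "2 * l + 1"] n2 by (simp only: V_def l degM R_def)
  moreover have "N \<le> 2 * n" using n2 by (auto simp: N_def)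
  ultimately have "monom 1 N dvd reflect_poly V - (R ^ Suc (2 * l + 1) + monom 1 n * R ^ (2 * l + 1))"
    by (simp add: monom_1_dvd_iff')
  with v have c: "coeff ([:1, 1:] ^ v) i = coeff (R ^ Suc (2 * l + 1)) i + coeff (monom 1 n * R ^ (2 * l + 1)) i"
    if "i < N" for i
    using coeff_eq_of_monom_dvd[OF _ that] by (metis coeff_add)
  have "R ^ Suc (2 * l + 1) = (R ^ (l + 1)) ^ 2" 
  proof -
    have "Suc (2 * l + 1) = (l + 1) * 2" by simp
    then show ?thesis by (simp only: power_mult)
  qed
  then have sq: "coeff (R ^ Suc (2 * l + 1)) i = 0" if "odd i" for i
    using coeff_square_odd[OF that] by simp
  have "coeff ([:1, 1:] ^ v :: bit poly) 1 = 0"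
    using c[of 1] sq[of 1] n2 by (simp add: N_def coeff_monom_mult)
  then have "even v" by (simp only: linear_power_coeff_1 bit_of_nat) (auto split: if_splits)
  then have "[:1, 1:] ^ v = ([:1, 1:] ^ (v div 2)) ^ (2 :: nat)"
    by (simp flip: power_mult)
  moreover have j: "odd j" "j < N" "j \<ge> n" by (auto simp: j_def N_def)
  ultimately have "coeff ([:1, 1:] ^ v :: bit poly) j = 0"
    using coeff_square_odd by metis
  then have "coeff (R ^ (2 * l + 1)) (j - n) = 0"
    using c[OF j(2)] sq[OF j(1)] j(3) by (simp add: coeff_monom_mult)
  moreover have R0: "coeff R 0 = 1"
  proof -
    have "lead_coeff M \<noteq> 0" using irr by (simp only: leading_coeff_0_iff) auto
    then show ?thesis unfolding R_def by (simp only: bit_not_zero_iff coeff_0_reflect_poly)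
  qed
  moreover have "coeff (R ^ (2 * l + 1)) (j - n) = 1"
  proof (cases "odd n")
    case True
    have "coeff (R ^ (2 * l + 1)) 0 = 1" by (simp only: coeff_0_power R0 power_one)
    with True show ?thesis by (simp add: j_def)
  next
    case False
    have "odd b" using False mersenne_not_both_even[of a b] irr M by (auto simp: n_def)
    then have R1: "coeff R 1 = 1"
      using reflect_mersenne[of a b] M n2
      by (simp only: R_def coeff_add linear_power_coeff_1 bit_of_nat) simp
    have "R ^ (2 * l + 1) = (R ^ l) ^ 2 * R" by (simp add: mult.commute flip: power_mult)
    then have "coeff (R ^ (2 * l + 1)) 1 = 1"
      using coeff_square_odd[of 1 "R ^ l"] R0 R1 by (simp only: coeff_mult_1) (simp add: coeff_0_power)
    then show ?thesis using False by (simp add: j_def)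
  qed
  ultimately show False by simp
qed

section \<open>Exceptional primes\<close>

text \<open>
  For the small primes out of reach of the leading-coefficient argument, an explicit divisor \<open>W\<close>
  of the geometric sum, found by factoring it, has no Mersenne divisor of an admissible degree.
\<close>

lemma not_dvd_mersenneI:
  fixes L :: "(nat \<times> nat \<times> bit poly \<times> bit poly) list"
  assumes "\<forall>(c, d, Q, R)\<in>set L. W = Q * (1 + polyX ^ c * (polyX + 1) ^ d) + R \<and>
      R \<noteq> 0 \<and> degree R < c + d"
    and "(c, d) \<in> set (map (\<lambda>(c, d, Q, R). (c, d)) L)"
  shows "\<not> 1 + polyX ^ c * (polyX + 1) ^ d dvd W"
proof
  let ?P = "1 + polyX ^ c * (polyX + 1) ^ d"
  assume dvd: "?P dvd W"
  from assms obtain Q R where QR: "W = Q * ?P + R" "R \<noteq> 0" "degree R < c + d" by auto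
  then have "?P dvd R" using dvd by (simp only: dvd_add_right_iff dvd_triv_right)
  then have "degree ?P \<le> degree R" using QR(2) by (rule dvd_imp_degree_le)
  then show False using QR(3) by simp
qed

lemma mersenne_dvd_degree:
  assumes "1 + polyX ^ c * (polyX + 1) ^ d dvd W" "W \<noteq> 0"
  shows "c + d \<le> degree W"
  using dvd_imp_degree_le[OF assms] by simp

text \<open>Serves \<open>M_1\<close> with three terms, and \<open>M_3\<close> and its conjugate
  with five; there every irreducible factor has even degree.\<close>

lemma mersenne_not_dvd_deg_4:
  assumes "c > 0" "d > 0" "even (c + d)"
  shows "\<not> 1 + polyX ^ c * (polyX + 1) ^ d dvd [:1, 1, 0, 0, 1:]"
proof
  assume dvd: "1 + polyX ^ c * (polyX + 1) ^ d dvd [:1, 1, 0, 0, 1:]"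
  \<comment> \<open>An entry \<open>(c, d, Q, R)\<close> records quotient and nonzero remainder of
    the division by the Mersenne polynomial with exponents \<open>c\<close> and \<open>d\<close>.
    The entries exhaust the positive pairs of even sum at most 4.\<close>
  let ?L = "[
    (1, 1, [:0, 1, 1:], [:1:]),
    (1, 3, [:1:], [:0, 0, 1, 1:]),
    (2, 2, [:1:], [:0, 1, 1:]),
    (3, 1, [:1:], [:0, 1, 0, 1:])] :: (nat \<times> nat \<times> bit poly \<times> bit poly) list"
  have "c + d \<le> 4" using mersenne_dvd_degree[OF dvd] by simp
  with assms have "(c, d) \<in> set (map (\<lambda>(c, d, Q, R). (c, d)) ?L)"
    by simp presburger
  moreover have "\<forall>(c, d, Q, R)\<in>set ?L. [:1, 1, 0, 0, 1:] = Q * (1 + polyX ^ c * (polyX + 1) ^ d) + R \<and>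
      R \<noteq> 0 \<and> degree R < c + d"
    by (simp add: eval_nat_numeral one_pCons)
  ultimately show False using not_dvd_mersenneI dvd by blast
qed

lemma mersenne_not_dvd_deg_6_1:
  assumes "c > 0" "d > 0" "3 dvd c + d"
  shows "\<not> 1 + polyX ^ c * (polyX + 1) ^ d dvd [:1, 0, 1, 1, 0, 1, 1:]"
proof
  assume dvd: "1 + polyX ^ c * (polyX + 1) ^ d dvd [:1, 0, 1, 1, 0, 1, 1:]"
  let ?L = "[
    (1, 2, [:1, 1, 1, 1:], [:0, 0, 1:]),
    (2, 1, [:0, 0, 0, 1:], [:1, 0, 1:]),
    (1, 5, [:1:], [:0, 1, 0, 1:]),
    (2, 4, [:1:], [:0, 0, 0, 1, 0, 1:]),
    (3, 3, [:1:], [:0, 0, 1, 0, 1:]),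
    (4, 2, [:1:], [:0, 0, 1, 1, 1, 1:]),
    (5, 1, [:1:], [:0, 0, 1, 1:])] :: (nat \<times> nat \<times> bit poly \<times> bit poly) list"
  have "c + d \<le> 6" using mersenne_dvd_degree[OF dvd] by simp
  with assms have "(c, d) \<in> set (map (\<lambda>(c, d, Q, R). (c, d)) ?L)"
    by simp presburger
  moreover have "\<forall>(c, d, Q, R)\<in>set ?L. [:1, 0, 1, 1, 0, 1, 1:] = Q * (1 + polyX ^ c * (polyX + 1) ^ d) + R \<and>
      R \<noteq> 0 \<and> degree R < c + d"
    by (simp add: eval_nat_numeral one_pCons)
  ultimately show False using not_dvd_mersenneI dvd by blast
qed

text \<open>Even degrees serve \<open>M_2\<close> with nine terms, multiples of 3 serve the
  conjugate of \<open>M_3\<close> with seven terms.\<close>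

lemma mersenne_not_dvd_deg_6_2:
  assumes "c > 0" "d > 0" "even (c + d) \<or> 3 dvd c + d"
  shows "\<not> 1 + polyX ^ c * (polyX + 1) ^ d dvd [:1, 1, 0, 0, 0, 0, 1:]"
proof
  assume dvd: "1 + polyX ^ c * (polyX + 1) ^ d dvd [:1, 1, 0, 0, 0, 0, 1:]"
  let ?L = "[
    (1, 1, [:1, 1, 0, 1, 1:], [:0, 1:]),
    (1, 2, [:1, 1, 0, 1:], [:0, 1, 1:]),
    (2, 1, [:0, 1, 1, 1:], [:1, 0, 1:]),
    (1, 3, [:0, 1, 1:], [:1:]),
    (2, 2, [:1, 0, 1:], [:0, 1:]),
    (3, 1, [:1, 1, 1:], [:0, 0, 1, 1:]),
    (1, 5, [:1:], [:0, 0, 1, 0, 0, 1:]),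
    (2, 4, [:1:], [:0, 1, 1:]),
    (3, 3, [:1:], [:0, 1, 0, 1, 1, 1:]),
    (4, 2, [:1:], [:0, 1, 0, 0, 1:]),
    (5, 1, [:1:], [:0, 1, 0, 0, 0, 1:])] :: (nat \<times> nat \<times> bit poly \<times> bit poly) list"
  have "c + d \<le> 6" using mersenne_dvd_degree[OF dvd] by simp
  with assms have "(c, d) \<in> set (map (\<lambda>(c, d, Q, R). (c, d)) ?L)"
    by simp presburger
  moreover have "\<forall>(c, d, Q, R)\<in>set ?L. [:1, 1, 0, 0, 0, 0, 1:] = Q * (1 + polyX ^ c * (polyX + 1) ^ d) + R \<and>
      R \<noteq> 0 \<and> degree R < c + d"
    by (simp add: eval_nat_numeral one_pCons)
  ultimately show False using not_dvd_mersenneI dvd by blast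
qed

text \<open>Even degrees serve the conjugate of \<open>M_2\<close> with nine terms, multiples of 3
  serve \<open>M_3\<close> with seven terms.\<close>

lemma mersenne_not_dvd_deg_6_3:
  assumes "c > 0" "d > 0" "even (c + d) \<or> 3 dvd c + d"
  shows "\<not> 1 + polyX ^ c * (polyX + 1) ^ d dvd [:1, 1, 1, 0, 1, 0, 1:]"
proof
  assume dvd: "1 + polyX ^ c * (polyX + 1) ^ d dvd [:1, 1, 1, 0, 1, 0, 1:]"
  let ?L = "[
    (1, 1, [:0, 0, 1, 1, 1:], [:1, 1:]),
    (1, 2, [:1, 0, 0, 1:], [:0, 0, 1:]),
    (2, 1, [:1, 0, 1, 1:], [:0, 1, 1:]),
    (1, 3, [:1, 1, 1:], [:0, 1, 0, 1:]),
    (2, 2, [:0, 0, 1:], [:1, 1:]),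
    (3, 1, [:0, 1, 1:], [:1:]),
    (1, 5, [:1:], [:0, 0, 0, 0, 1, 1:]),
    (2, 4, [:1:], [:0, 1, 0, 0, 1:]),
    (3, 3, [:1:], [:0, 1, 1, 1, 0, 1:]),
    (4, 2, [:1:], [:0, 1, 1:]),
    (5, 1, [:1:], [:0, 1, 1, 0, 1, 1:])] :: (nat \<times> nat \<times> bit poly \<times> bit poly) list"
  have "c + d \<le> 6" using mersenne_dvd_degree[OF dvd] by simp
  with assms have "(c, d) \<in> set (map (\<lambda>(c, d, Q, R). (c, d)) ?L)"
    by simp presburger
  moreover have "\<forall>(c, d, Q, R)\<in>set ?L. [:1, 1, 1, 0, 1, 0, 1:] = Q * (1 + polyX ^ c * (polyX + 1) ^ d) + R \<and>
      R \<noteq> 0 \<and> degree R < c + d"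
    by (simp add: eval_nat_numeral one_pCons)
  ultimately show False using not_dvd_mersenneI dvd by blast
qed

lemma mersenne_not_dvd_deg_9_1:
  assumes "c > 0" "d > 0" "3 dvd c + d"
  shows "\<not> 1 + polyX ^ c * (polyX + 1) ^ d dvd [:1, 1, 0, 0, 0, 1, 0, 1, 0, 1:]"
proof
  assume dvd: "1 + polyX ^ c * (polyX + 1) ^ d dvd [:1, 1, 0, 0, 0, 1, 0, 1, 0, 1:]"
  let ?L = "[
    (1, 2, [:0, 1, 1, 1, 0, 0, 1:], [:1:]),
    (2, 1, [:0, 1, 1, 1, 0, 1, 1:], [:1, 0, 1:]),
    (1, 5, [:0, 0, 1, 1:], [:1, 1, 1:]),
    (2, 4, [:0, 1, 0, 1:], [:1:]),
    (3, 3, [:1, 1, 1, 1:], [:0, 0, 1:]),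
    (4, 2, [:0, 0, 0, 1:], [:1, 1, 0, 1, 0, 1:]),
    (5, 1, [:0, 0, 1, 1:], [:1, 1, 1, 1, 0, 1:]),
    (1, 8, [:1:], [:0, 0, 0, 0, 0, 1, 0, 1:]),
    (2, 7, [:1:], [:0, 1, 1, 1, 1, 0, 1, 0, 1:]),
    (3, 6, [:1:], [:0, 1, 0, 1:]),
    (4, 5, [:1:], [:0, 1, 0, 0, 1, 0, 0, 1, 1:]),
    (5, 4, [:1:], [:0, 1, 0, 0, 0, 0, 0, 1:]),
    (6, 3, [:1:], [:0, 1, 0, 0, 0, 1, 1, 0, 1:]),
    (7, 2, [:1:], [:0, 1, 0, 0, 0, 1:]),
    (8, 1, [:1:], [:0, 1, 0, 0, 0, 1, 0, 1, 1:])] :: (nat \<times> nat \<times> bit poly \<times> bit poly) list"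
  have "c + d \<le> 9" using mersenne_dvd_degree[OF dvd] by simp
  with assms have "(c, d) \<in> set (map (\<lambda>(c, d, Q, R). (c, d)) ?L)"
    by simp presburger
  moreover have "\<forall>(c, d, Q, R)\<in>set ?L. [:1, 1, 0, 0, 0, 1, 0, 1, 0, 1:] = Q * (1 + polyX ^ c * (polyX + 1) ^ d) + R \<and>
      R \<noteq> 0 \<and> degree R < c + d"
    by (simp add: eval_nat_numeral one_pCons)
  ultimately show False using not_dvd_mersenneI dvd by blast
qed

lemma mersenne_not_dvd_deg_9_2:
  assumes "c > 0" "d > 0" "3 dvd c + d"
  shows "\<not> 1 + polyX ^ c * (polyX + 1) ^ d dvd [:1, 0, 1, 1, 0, 0, 1, 1, 1, 1:]"
proof
  assume dvd: "1 + polyX ^ c * (polyX + 1) ^ d dvd [:1, 0, 1, 1, 0, 0, 1, 1, 1, 1:]"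
  let ?L = "[
    (1, 2, [:1, 1, 1, 1, 0, 1, 1:], [:0, 0, 1:]),
    (2, 1, [:0, 0, 1, 1, 1, 0, 1:], [:1:]),
    (1, 5, [:0, 1, 0, 1:], [:1, 1, 0, 1, 1, 1:]),
    (2, 4, [:1, 1, 1, 1:], [:0, 1, 1, 1, 1, 1:]),
    (3, 3, [:0, 0, 0, 1:], [:1, 0, 1:]),
    (4, 2, [:0, 0, 1, 1:], [:1:]),
    (5, 1, [:0, 1, 0, 1:], [:1, 1, 1:]),
    (1, 8, [:1:], [:0, 1, 1, 1, 0, 0, 1, 1, 1:]),
    (2, 7, [:1:], [:0, 0, 0, 0, 1, 1:]),
    (3, 6, [:1:], [:0, 0, 1, 0, 0, 1, 1, 0, 1:]),
    (4, 5, [:1:], [:0, 0, 1, 1, 1, 1, 1, 1:]),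
    (5, 4, [:1:], [:0, 0, 1, 1, 0, 1, 1, 1, 1:]),
    (6, 3, [:1:], [:0, 0, 1, 1:]),
    (7, 2, [:1:], [:0, 0, 1, 1, 0, 0, 1, 0, 1:]),
    (8, 1, [:1:], [:0, 0, 1, 1, 0, 0, 1, 1:])] :: (nat \<times> nat \<times> bit poly \<times> bit poly) list"
  have "c + d \<le> 9" using mersenne_dvd_degree[OF dvd] by simp
  with assms have "(c, d) \<in> set (map (\<lambda>(c, d, Q, R). (c, d)) ?L)"
    by simp presburger
  moreover have "\<forall>(c, d, Q, R)\<in>set ?L. [:1, 0, 1, 1, 0, 0, 1, 1, 1, 1:] = Q * (1 + polyX ^ c * (polyX + 1) ^ d) + R \<and>
      R \<noteq> 0 \<and> degree R < c + d"
    by (simp add: eval_nat_numeral one_pCons)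
  ultimately show False using not_dvd_mersenneI dvd by blast
qed

lemma not_coprime_cases:
  assumes "\<not> coprime (q :: nat) r" "prime q"
  shows "q dvd r"
  using assms prime_imp_coprime by blast

lemma three_dvd_imp_even:
  assumes "3 dvd 2 ^ d - (1 :: nat)"
  shows "even d"
proof (rule ccontr)
  assume "odd d"
  then obtain k where "d = 2 * k + 1" by (elim oddE)
  have "(4 ^ k :: nat) mod 3 = 1" by (induction k) (simp_all add: mod_mult_right_eq[symmetric])
  then have "(2 ^ d :: nat) mod 3 = 2"
    by (simp add: \<open>d = 2 * k + 1\<close> power_mult mod_mult_right_eq[symmetric])
  moreover have "(2 ^ d :: nat) = 2 ^ d - 1 + 1" by simp
  ultimately show False using assms by presburger
qed

section \<open>The exponent three\<close>

lemma irreducible_quadratic: "irreducible ([:1, 1, 1:] :: bit poly)"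
proof -
  obtain P :: "bit poly" where P: "irreducible P" "P dvd [:1, 1, 1:]"
    using ex_irreducible_factor[of "[:1, 1, 1:]"] by auto
  then obtain R where R: "[:1, 1, 1:] = P * R" by blast
  then have nz: "P \<noteq> 0" "R \<noteq> 0" by auto
  have "degree P + degree R = 2"
    using arg_cong[OF R, of degree] nz by (simp add: degree_mult_eq)
  moreover have "degree P \<noteq> 1"
  proof
    assume "degree P = 1"
    then obtain c d where cd: "P = [:c, d:]" "d \<noteq> 0"
      by (rule degree1_coeffs)
    \<comment> \<open>In characteristic two the root of \<open>X + c\<close> is
      \<open>c\<close>.\<close>
    then have "poly P c = 0" by (cases c) simp_all
    then have "poly [:1, 1, 1 :: bit:] c = 0" by (simp only: R poly_mult mult_zero_left)
    then show False by (cases c) simp_all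
  qed
  ultimately have "degree R = 0" using irreducible_degree_pos[OF P(1)] by linarith
  then show ?thesis using R P(1) bit_poly_degree_0[OF nz(2)] by simp
qed

lemma mersenne_degree_2:
  assumes "mersenne_prime_poly P" "degree P = 2"
  shows "P = [:1, 1, 1:]"
proof -
  obtain c d where cd: "c > 0" "d > 0" "P = 1 + polyX ^ c * (polyX + 1) ^ d"
    using assms(1) by (auto simp: mersenne_prime_poly_def)
  with assms(2) have "c = 1" "d = 1" by simp_all
  then show ?thesis by (simp add: cd one_pCons)
qed

text \<open>
  For \<open>p = 3\<close> the polynomial \<open>1 + x + x\<^sup>2\<close> is a simple factor of \<open>1 + M + M\<^sup>2\<close> and all other
  irreducible factors have even degree at least \<open>4\<close>, which is visible in the four leading
  coefficients.
\<close>

lemma cube_factor: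
  assumes irr: "irreducible M" and M: "M = 1 + polyX ^ a * (polyX + 1) ^ b" "a > 0" "b > 0" "a + b \<ge> 4"
  shows "\<exists>P. irreducible P \<and> \<not> mersenne_prime_poly P \<and> P dvd (\<Sum>i<3. M ^ i)"
proof (rule ccontr)
  assume contra: "\<not> ?thesis"
  define V where "V = (\<Sum>i<3. M ^ i)"
  have V: "V = 1 + M + M ^ 2" by (simp add: V_def eval_nat_numeral)
  have degM: "degree M = a + b" by (simp add: M)
  have "degree M > 0" using M(4) degM by linarith
  then have "degree (\<Sum>i<Suc 2. M ^ i) = 2 * degree M" by (rule degree_geometric)
  moreover have "Suc 2 = 3" by simp
  ultimately have "degree V = 2 * (a + b)" by (simp only: V_def degM)
  then have V0: "V \<noteq> 0" using M(4) by auto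
  obtain x where x: "ev [:1, 1, 1:] x = 0" using ex_ev_root[of "[:1, 1, 1:]"] by auto
  then have xx: "x ^ 2 = x + 1"
    by (metis (no_types, lifting) ac_add_eq_0_iff ev_pCons ev_0 to_ac_1 mult_zero_right add_0_right
        mult_1_right distrib_left power2_eq_square add.assoc add.commute)
  have x0: "x \<noteq> 0" "x + 1 \<noteq> 0" using xx x by auto
  \<comment> \<open>The value of \<open>M\<close> at \<open>x\<close> lies in the field with four
    elements and is neither 0 nor 1, so it is a primitive cube root of unity.\<close>
  have "[:1, 1, 1:] dvd V"
  proof -
    have "x ^ (2 ^ 2) = x" using frobenius_orbit(1)[OF irreducible_quadratic x] by simp
    then have "ev M x ^ (2 ^ 2) = ev M x" by (metis ev_power2_power)
    then have "ev M x * ((ev M x - 1) * ev V x) = 0"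
      by (simp add: V algebra_simps eval_nat_numeral)
    moreover have "ev M x \<noteq> 0"
    proof
      assume "ev M x = 0"
      then have "[:1, 1, 1:] dvd M" by (rule irreducible_ev_dvd[OF irreducible_quadratic x])
      then have "[:1, 1, 1:] = M" using irreducible_dvd_irreducible irreducible_quadratic irr by blast
      then have "degree [:1, 1, 1 :: bit:] = degree M" by simp
      then show False using M(4) degM by simp
    qed
    moreover have "ev M x - 1 \<noteq> 0" using x0 by (simp add: M)
    ultimately have "ev V x = 0" by simp
    then show ?thesis by (rule irreducible_ev_dvd[OF irreducible_quadratic x])
  qed
  then obtain U where U: "V = [:1, 1, 1:] * U" by blast
  \<comment> \<open>A double factor would make \<open>V' = M'\<close> vanish at \<open>x\<close>.
    But \<open>M'\<close> is \<open>x^(a-1) (x+1)^(b-1) (a (x+1) + b x)\<close>, and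
    \<open>a\<close> and \<open>b\<close> are not both even.\<close>
  have notU: "\<not> [:1, 1, 1:] dvd U"
  proof
    assume "[:1, 1, 1:] dvd U"
    then obtain T where "V = [:1, 1, 1:] * ([:1, 1, 1:] * T)" using U by blast
    then have "pderiv V = pderiv ([:1, 1, 1:] * ([:1, 1, 1:] * T))" by (rule arg_cong)
    then have "ev (pderiv V) x = 0"
      unfolding pderiv_mult by (simp only: ev_add ev_mult x) simp
    moreover have "pderiv V = pderiv M"
      by (simp add: V pderiv_add power2_eq_square pderiv_mult mult.commute)
    moreover obtain a' b' where ab': "a = Suc a'" "b = Suc b'" using M by (metis gr0_implies_Suc)
    moreover have "ev (pderiv M) x = x ^ a' * (x + 1) ^ b' * (of_nat a * (x + 1) + of_nat b * x)"
    proof -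
      have XY: "pderiv polyX = 1" "pderiv (polyX + 1) = 1" by (simp_all add: one_pCons pderiv_pCons)
      have sm: "ev (of_nat k) x = of_nat k" for k by (induction k) simp_all
      show ?thesis
        unfolding M ab' pderiv_add pderiv_mult pderiv_power_Suc XY
        by (simp add: sm algebra_simps del: of_nat_Suc)
    qed
    ultimately have "of_nat a * (x + 1) + of_nat b * x = 0" using x0 by simp
    moreover have "odd a \<or> odd b" using mersenne_not_both_even irr M by blast
    moreover have "x + 1 + x = 1" by (metis ac_add_self add.assoc add.commute add_0_right)
    ultimately show False using x0 by (cases "even a"; cases "even b") (simp_all add: ac_of_nat)
  qed
  have "U \<noteq> 0" using U V0 by auto
  moreover have "mersenne_prime_poly P \<and> 4 \<le> degree P" if P: "irreducible P" "P dvd U" for P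
  proof -
    have "P dvd V" using P U by (metis dvd_mult)
    then have mp: "mersenne_prime_poly P" using contra P by (auto simp: V_def)
    have "3 dvd (2 ^ degree P - 1 :: nat)"
      using geometric_factor_degree[OF P(1), of M 3] \<open>P dvd V\<close> not_coprime_cases[of 3] by (simp add: V_def)
    then have "even (degree P)" by (rule three_dvd_imp_even)
    moreover have "degree P \<noteq> 2"
      using mersenne_degree_2[OF mp] notU P(2) by auto
    moreover have "degree P > 0" using irreducible_degree_pos[OF P(1)] .
    ultimately show ?thesis using mp by presburger
  qed
  ultimately obtain v where v: "monom 1 4 dvd reflect_poly U - [:1, 1:] ^ v"
    using reflect_product_of_mersenne[of U 4] by blast
  define R where "R = reflect_poly M"
  have d: "monom 1 (2 * (a + b)) dvd reflect_poly V - (R ^ 2 + monom 1 (a + b) * R)"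
    using reflect_geometric[of M 1] M(2) by (simp only: V_def R_def degM) (simp add: eval_nat_numeral)
  \<comment> \<open>The term \<open>z^(a+b) R\<close> starts beyond degree 3 because
    \<open>a + b\<close> is at least 4.\<close>
  have "coeff (reflect_poly V) j = coeff (R ^ 2) j" if "j < 4" for j
  proof -
    have "j < 2 * (a + b)" "j < a + b" using that M(4) by auto
    then show ?thesis
      using coeff_eq_of_monom_dvd[OF d, of j] by (simp add: coeff_monom_mult)
  qed
  moreover have "reflect_poly V = [:1, 1, 1:] * reflect_poly U"
  proof -
    have "reflect_poly [:1, 1, 1 :: bit:] = [:1, 1, 1:]" by (simp add: reflect_poly_def cCons_def)
    then show ?thesis by (simp only: U reflect_poly_mult)
  qed
  moreover have "monom 1 4 dvd [:1, 1, 1:] * reflect_poly U - [:1, 1, 1:] * [:1, 1:] ^ v"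
    using v unfolding right_diff_distrib[symmetric] by (rule dvd_mult)
  ultimately have c: "coeff ([:1, 1, 1:] * [:1, 1:] ^ v) j = coeff (R ^ 2) j" if "j < 4" for j
    using coeff_eq_of_monom_dvd that by metis
  \<comment> \<open>The product has linear coefficient \<open>v + 1\<close>, whereas the square
    \<open>R^2\<close> has no linear term.\<close>
  have "odd v"
  proof
    assume "even v"
    have "coeff ([:1, 1, 1 :: bit:] * [:1, 1:] ^ v) 1 = 1 * coeff ([:1, 1:] ^ v) 1 + 1 * coeff ([:1, 1:] ^ v :: bit poly) 0"
      by (simp only: coeff_mult_1) simp
    also have "\<dots> = 1"
      using \<open>even v\<close> by (simp only: linear_power_coeff_1 bit_of_nat coeff_0_power) simp
    finally show False using c[of 1] coeff_square_odd[of 1 R] by simp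
  qed
  then obtain w where w: "v = 2 * w + 1" by (elim oddE)
  define S :: "bit poly" where "S = [:1, 1:] ^ w"
  have "[:1, 1:] ^ v = [:1, 1:] * S ^ 2" by (simp add: w S_def mult.commute flip: power_mult)
  then have "[:1, 1, 1:] * [:1, 1:] ^ v = ([:1, 1, 1:] * [:1, 1:]) * S ^ 2" by (simp only: mult.assoc)
  \<comment> \<open>The factor \<open>1 + z^3\<close> produces a coefficient 1 at
    \<open>z^3\<close>, where the square \<open>R^2\<close> has coefficient 0.\<close>
  also have "[:1, 1, 1:] * [:1, 1:] = 1 + monom (1 :: bit) 3" by (simp add: eval_nat_numeral monom_Suc monom_0 one_pCons)
  finally have "coeff (S ^ 2 + monom 1 3 * S ^ 2) 3 = coeff (R ^ 2) 3"
    using c[of 3] by (simp add: distrib_right)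
  moreover have "coeff S 0 = 1" unfolding S_def by (simp only: coeff_0_power) simp
  ultimately show False
    using coeff_square_odd[of 3 S] coeff_square_odd[of 3 R]
    by (simp add: coeff_monom_mult coeff_0_power)
qed

text \<open>Any irreducible factor of \<open>W\<close> will do: were it Mersenne, its degree would
  obey \<open>geometric_factor_degree\<close>, and such divisors of \<open>W\<close> are
  excluded.\<close>

lemma explicit_factor:
  assumes "W dvd (\<Sum>i<N. M ^ i)" "degree W > 0" "odd N"
    and W: "\<And>c d. c > 0 \<Longrightarrow> d > 0 \<Longrightarrow> \<not> coprime N (2 ^ (c + d) - 1) \<Longrightarrow>
              \<not> 1 + polyX ^ c * (polyX + 1) ^ d dvd W"
  shows "\<exists>P. irreducible P \<and> \<not> mersenne_prime_poly P \<and> P dvd (\<Sum>i<N. M ^ i)"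
proof -
  obtain P where P: "irreducible P" "P dvd W" using ex_irreducible_factor assms(2) by blast
  then have PS: "P dvd (\<Sum>i<N. M ^ i)" using assms(1) dvd_trans by blast
  have "\<not> mersenne_prime_poly P"
  proof
    assume "mersenne_prime_poly P"
    then obtain c d where cd: "c > 0" "d > 0" "P = 1 + polyX ^ c * (polyX + 1) ^ d"
      by (auto simp: mersenne_prime_poly_def)
    then have "degree P = c + d" by simp
    then show False using geometric_factor_degree[OF P(1) PS assms(3)] W[OF cd(1,2)] P(2) cd(3) by simp
  qed
  then show ?thesis using P(1) PS by blast
qed

section \<open>Orders of 2 modulo small primes\<close>

lemma dvd_power_minus_1_mod:
  assumes "q dvd 2 ^ d - (1 :: nat)" "q > 1"
  shows "2 ^ d mod q = 1"
proof -
  obtain e where "2 ^ d - (1 :: nat) = q * e" using assms(1) by blast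
  then have "(2 :: nat) ^ d = q * e + 1"
    by (metis Suc_eq_plus1 Suc_pred' One_nat_def zero_less_numeral zero_less_power)
  then show ?thesis using assms(2) by (simp only: mod_mult_self4 mod_less)
qed

lemma five_dvd_imp_even:
  assumes "5 dvd 2 ^ d - (1 :: nat)"
  shows "even d"
proof (rule ccontr)
  assume "odd d"
  then obtain k where k: "d = 2 * k + 1" by (elim oddE)
  have "(4 ^ k :: nat) mod 5 = 1 \<or> (4 ^ k :: nat) mod 5 = 4"
  proof (induction k)
    case (Suc k)
    have "(4 ^ Suc k :: nat) mod 5 = 4 * (4 ^ k mod 5) mod 5"
      by (simp only: power_Suc mod_mult_right_eq)
    with Suc show ?case by auto
  qed simp
  then have "(2 * 4 ^ k :: nat) mod 5 \<noteq> 1"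
    by (subst mod_mult_right_eq[symmetric]) auto
  then show False
    using dvd_power_minus_1_mod[OF assms] by (simp add: k power_mult)
qed

lemma seven_dvd_imp_three_dvd:
  assumes "7 dvd 2 ^ d - (1 :: nat)"
  shows "3 dvd d"
proof (rule ccontr)
  define k where "k = d div 3"
  assume "\<not> 3 dvd d"
  then have "d = 3 * k + 1 \<or> d = 3 * k + 2" unfolding k_def by presburger
  then have d: "(2 ^ d :: nat) = 2 * 8 ^ k \<or> (2 ^ d :: nat) = 4 * 8 ^ k"
    by (auto simp: power_add power_mult)
  have 8: "(8 ^ k :: nat) mod 7 = 1"
    by (induction k) (auto simp: mod_mult_right_eq[of 8, symmetric])
  have "(c * 8 ^ k) mod 7 = c mod 7" for c :: nat
    by (subst mod_mult_right_eq[symmetric]) (simp add: 8)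
  from this[of 2] this[of 4] show False
    using dvd_power_minus_1_mod[OF assms] d by auto
qed

text \<open>For \<open>d\<close> from 1 to 5 the numbers \<open>2^d - 1\<close> are 1, 3, 7, 15 and
  31.\<close>

lemma prime_dvd_small_mersenne_number:
  assumes q: "prime q" "q dvd 2 ^ d - (1 :: nat)" and d: "d > 0" "q \<noteq> 3" "q \<noteq> 7"
  shows "d \<ge> 4" and "q \<noteq> 5 \<Longrightarrow> q \<noteq> 31 \<Longrightarrow> d \<ge> 6"
proof -
  have p: "prime (3 :: nat)" "prime (5 :: nat)" "prime (7 :: nat)" "prime (31 :: nat)" by simp_all
  have eq: "q = r" if "q dvd r" "prime r" for r using that q(1) primes_dvd_imp_eq by blast
  have "d \<noteq> 1" using q by auto
  moreover have "d \<noteq> 2" using q eq[OF _ p(1)] d by auto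
  moreover have "d \<noteq> 3" using q eq[OF _ p(3)] d by auto
  ultimately show "d \<ge> 4" using d by linarith
  moreover assume "q \<noteq> 5" "q \<noteq> 31"
  moreover have "d \<noteq> 4"
  proof
    assume "d = 4"
    then have "q dvd 3 * 5" using q by simp
    then show False using eq[OF _ p(1)] eq[OF _ p(2)] prime_dvd_multD[OF q(1)] d \<open>q \<noteq> 5\<close> by blast
  qed
  moreover have "d \<noteq> 5" using q eq[OF _ p(4)] \<open>q \<noteq> 31\<close> by auto
  ultimately show "d \<ge> 6" by linarith
qed

section \<open>Case analysis over the small Mersenne polynomials\<close>

definition has_non_mersenne_factor :: "bit poly \<Rightarrow> bool"
  where "has_non_mersenne_factor V \<longleftrightarrow> (\<exists>P. irreducible P \<and> \<not> mersenne_prime_poly P \<and> P dvd V)"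

lemma Mersenne_M_1: "Mersenne_M 1 = [:1, 1, 1:]"
  and Mersenne_M_2: "Mersenne_M 2 = [:1, 1, 0, 1:]"
  and Mersenne_M_3: "Mersenne_M 3 = [:1, 1, 1, 1, 1:]"
  and bar_poly_M2: "bar_poly [:1, 1, 0, 1:] = [:1, 0, 1, 1:]"
  and bar_poly_M3: "bar_poly [:1, 1, 1, 1, 1:] = [:1, 0, 0, 1, 1:]"
  by (simp_all add: Mersenne_M_def bar_poly_def eval_nat_numeral one_pCons pcompose_pCons)

lemma mersenne_form:
  "[:1, 1, 1:] = 1 + polyX ^ 1 * (polyX + 1) ^ 1"
  "[:1, 1, 0, 1:] = 1 + polyX ^ 1 * (polyX + 1) ^ 2"
  "[:1, 0, 1, 1:] = 1 + polyX ^ 2 * (polyX + 1) ^ 1"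
  "[:1, 1, 1, 1, 1:] = 1 + polyX ^ 1 * (polyX + 1) ^ 3"
  "[:1, 0, 0, 1, 1:] = 1 + polyX ^ 3 * (polyX + 1) ^ 1"
  by (simp_all add: eval_nat_numeral one_pCons)

lemma not_coprime_3: "\<not> coprime 3 (2 ^ d - (1 :: nat)) \<Longrightarrow> even d"
  using not_coprime_cases[of 3] three_dvd_imp_even by simp

lemma not_coprime_5: "\<not> coprime 5 (2 ^ d - (1 :: nat)) \<Longrightarrow> even d"
  using not_coprime_cases[of 5] five_dvd_imp_even by simp

lemma not_coprime_7: "\<not> coprime 7 (2 ^ d - (1 :: nat)) \<Longrightarrow> 3 dvd d"
  using not_coprime_cases[of 7] seven_dvd_imp_three_dvd by simp

lemma not_coprime_9: "\<not> coprime 9 (2 ^ d - (1 :: nat)) \<Longrightarrow> even d"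
proof -
  assume "\<not> coprime 9 (2 ^ d - (1 :: nat))"
  then have "\<not> coprime (3 ^ 2) (2 ^ d - (1 :: nat))" by simp
  then have "\<not> coprime 3 (2 ^ d - (1 :: nat))" by (simp only: coprime_power_left_iff) simp
  then show ?thesis by (rule not_coprime_3)
qed

lemma has_non_mersenne_factorI:
  assumes "(\<Sum>i<N. M ^ i) = W * C"
    and "\<And>d. \<not> coprime N (2 ^ d - 1) \<Longrightarrow> Q d"
    and "\<And>c d. c > 0 \<Longrightarrow> d > 0 \<Longrightarrow> Q (c + d) \<Longrightarrow> \<not> 1 + polyX ^ c * (polyX + 1) ^ d dvd W"
    and "degree W > 0" "odd N"
  shows "has_non_mersenne_factor (\<Sum>i<N. M ^ i)"
  unfolding has_non_mersenne_factor_def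
  using assms by (intro explicit_factor[of W]) auto

text \<open>The orders of 2 modulo 3 and 7 are 2 and 3, below the threshold 4 that
  \<open>large_degree_factor\<close> sets for \<open>M_1\<close>.\<close>

lemma exceptional_M1:
  "has_non_mersenne_factor (\<Sum>i<3. [:1, 1, 1:] ^ i)"
  "has_non_mersenne_factor (\<Sum>i<7. [:1, 1, 1:] ^ i)"
proof -
  have "(\<Sum>i<3. [:1, 1, 1:] ^ i) =
      [:1, 1, 0, 0, 1:] * (1 :: bit poly)"
    by (simp add: eval_nat_numeral one_pCons)
  then show "has_non_mersenne_factor (\<Sum>i<3. [:1, 1, 1:] ^ i)"
    by (rule has_non_mersenne_factorI[where Q = "even", OF _ not_coprime_3 mersenne_not_dvd_deg_4]) simp_all
  have "(\<Sum>i<7. [:1, 1, 1:] ^ i) =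
      [:1, 0, 1, 1, 0, 1, 1:] * ([:1, 1, 1, 1, 1, 1, 1:] :: bit poly)"
    by (simp add: eval_nat_numeral one_pCons)
  then show "has_non_mersenne_factor (\<Sum>i<7. [:1, 1, 1:] ^ i)"
    by (rule has_non_mersenne_factorI[where Q = "(dvd) 3", OF _ not_coprime_7 mersenne_not_dvd_deg_6_1]) simp_all
qed

text \<open>The exponent 9 replaces 3, because
  \<open>1 + M_2 + M_2^2 = (1 + x + x^2) (1 + x^3 + x^4)\<close> is a product of Mersenne primes.
  This is where \<open>h = 1\<close> has to be excluded.\<close>

lemma exceptional_M2:
  "has_non_mersenne_factor (\<Sum>i<7. [:1, 1, 0, 1:] ^ i)"
  "has_non_mersenne_factor (\<Sum>i<7. [:1, 0, 1, 1:] ^ i)"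
  "has_non_mersenne_factor (\<Sum>i<9. [:1, 1, 0, 1:] ^ i)"
  "has_non_mersenne_factor (\<Sum>i<9. [:1, 0, 1, 1:] ^ i)"
proof -
  have "(\<Sum>i<7. [:1, 1, 0, 1:] ^ i) =
      [:1, 1, 0, 0, 0, 1, 0, 1, 0, 1:] * ([:1, 0, 1, 1, 0, 1, 1, 1, 0, 1:] :: bit poly)"
    by (simp add: eval_nat_numeral one_pCons)
  then show "has_non_mersenne_factor (\<Sum>i<7. [:1, 1, 0, 1:] ^ i)"
    by (rule has_non_mersenne_factorI[where Q = "(dvd) 3", OF _ not_coprime_7 mersenne_not_dvd_deg_9_1]) simp_all
  have "(\<Sum>i<7. [:1, 0, 1, 1:] ^ i) =
      [:1, 0, 1, 1, 0, 0, 1, 1, 1, 1:] * ([:1, 0, 0, 0, 1, 0, 0, 1, 1, 1:] :: bit poly)"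
    by (simp add: eval_nat_numeral one_pCons)
  then show "has_non_mersenne_factor (\<Sum>i<7. [:1, 0, 1, 1:] ^ i)"
    by (rule has_non_mersenne_factorI[where Q = "(dvd) 3", OF _ not_coprime_7 mersenne_not_dvd_deg_9_2]) simp_all
  have "(\<Sum>i<9. [:1, 1, 0, 1:] ^ i) =
      [:1, 1, 0, 0, 0, 0, 1:] * ([:1, 1, 1, 1, 1, 1, 0, 0, 0, 0, 1, 1, 1, 0, 0, 1, 0, 0, 1:] :: bit poly)"
    by (simp add: eval_nat_numeral one_pCons)
  then show "has_non_mersenne_factor (\<Sum>i<9. [:1, 1, 0, 1:] ^ i)"
    by (rule has_non_mersenne_factorI[where Q = "even", OF _ not_coprime_9 mersenne_not_dvd_deg_6_2]) simp_all
  have "(\<Sum>i<9. [:1, 0, 1, 1:] ^ i) =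
      [:1, 1, 1, 0, 1, 0, 1:] * ([:1, 1, 0, 1, 0, 0, 1, 1, 0, 0, 1, 0, 0, 1, 1, 1, 1, 0, 1:] :: bit poly)"
    by (simp add: eval_nat_numeral one_pCons)
  then show "has_non_mersenne_factor (\<Sum>i<9. [:1, 0, 1, 1:] ^ i)"
    by (rule has_non_mersenne_factorI[where Q = "even", OF _ not_coprime_9 mersenne_not_dvd_deg_6_3]) simp_all
qed

text \<open>Degree 4 sets the threshold 6, while 2 has order 4 modulo 5 and order 3 modulo 7. The
  other primes of small order, 3 and 31, fall to \<open>cube_factor\<close> and
  \<open>mersenne_number_factor\<close>.\<close>

lemma exceptional_M3:
  "has_non_mersenne_factor (\<Sum>i<5. [:1, 1, 1, 1, 1:] ^ i)"
  "has_non_mersenne_factor (\<Sum>i<5. [:1, 0, 0, 1, 1:] ^ i)"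
  "has_non_mersenne_factor (\<Sum>i<7. [:1, 1, 1, 1, 1:] ^ i)"
  "has_non_mersenne_factor (\<Sum>i<7. [:1, 0, 0, 1, 1:] ^ i)"
proof -
  have "(\<Sum>i<5. [:1, 1, 1, 1, 1:] ^ i) =
      [:1, 1, 0, 0, 1:] * ([:1, 1, 1, 0, 1, 0, 1, 1, 1, 1, 0, 0, 1:] :: bit poly)"
    by (simp add: eval_nat_numeral one_pCons)
  then show "has_non_mersenne_factor (\<Sum>i<5. [:1, 1, 1, 1, 1:] ^ i)"
    by (rule has_non_mersenne_factorI[where Q = "even", OF _ not_coprime_5 mersenne_not_dvd_deg_4]) simp_all
  have "(\<Sum>i<5. [:1, 0, 0, 1, 1:] ^ i) =
      [:1, 1, 0, 0, 1:] * ([:1, 1, 1, 1, 0, 1, 0, 1, 1, 1, 0, 0, 1:] :: bit poly)"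
    by (simp add: eval_nat_numeral one_pCons)
  then show "has_non_mersenne_factor (\<Sum>i<5. [:1, 0, 0, 1, 1:] ^ i)"
    by (rule has_non_mersenne_factorI[where Q = "even", OF _ not_coprime_5 mersenne_not_dvd_deg_4]) simp_all
  have "(\<Sum>i<7. [:1, 1, 1, 1, 1:] ^ i) =
      [:1, 1, 1, 0, 1, 0, 1:] * ([:1, 0, 1, 1, 1, 1, 1, 0, 1, 0, 0, 1, 0, 0, 0, 0, 0, 0, 1:] :: bit poly)"
    by (simp add: eval_nat_numeral one_pCons)
  then show "has_non_mersenne_factor (\<Sum>i<7. [:1, 1, 1, 1, 1:] ^ i)"
    by (rule has_non_mersenne_factorI[where Q = "(dvd) 3", OF _ not_coprime_7 mersenne_not_dvd_deg_6_3]) simp_all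
  have "(\<Sum>i<7. [:1, 0, 0, 1, 1:] ^ i) =
      [:1, 1, 0, 0, 0, 0, 1:] * ([:1, 1, 1, 0, 1, 1, 1, 0, 0, 1, 1, 1, 0, 0, 0, 0, 1, 0, 1:] :: bit poly)"
    by (simp add: eval_nat_numeral one_pCons)
  then show "has_non_mersenne_factor (\<Sum>i<7. [:1, 0, 0, 1, 1:] ^ i)"
    by (rule has_non_mersenne_factorI[where Q = "(dvd) 3", OF _ not_coprime_7 mersenne_not_dvd_deg_6_2]) simp_all
qed

lemma mersenne_number_factor':
  assumes "mersenne_prime_poly M" "m \<ge> 5" "prime q" "q = 2 ^ m - 1"
  shows "has_non_mersenne_factor (\<Sum>i<q. M ^ i)"
  using mersenne_number_factor[OF assms(1,2)] assms(3,4)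
  by (simp add: has_non_mersenne_factor_def)

text \<open>\<open>B\<close> is a lower bound for the order of 2 modulo \<open>q\<close>, to be
  compared with the degree threshold of \<open>large_degree_factor\<close>.\<close>

lemma large_prime_factor:
  assumes irr: "irreducible M" and M: "M = 1 + polyX ^ a * (polyX + 1) ^ b" "a + b \<ge> 2"
    and q: "prime q" "odd q"
    and B: "(if odd (a + b) then a + b + 1 else a + b + 2) \<le> B"
    and deg: "\<And>d. q dvd 2 ^ d - 1 \<Longrightarrow> d > 0 \<Longrightarrow> B \<le> d"
  shows "has_non_mersenne_factor (\<Sum>i<q. M ^ i)"
  unfolding has_non_mersenne_factor_def
proof (rule large_degree_factor[OF irr M q(2)])
  show "q \<ge> 3" using q prime_ge_2_nat[of q] by (cases "q = 2") auto
  show "(if odd (a + b) then a + b + 1 else a + b + 2) \<le> degree P"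
    if P: "irreducible P" "P dvd (\<Sum>i<q. M ^ i)" for P
    using deg[OF _ irreducible_degree_pos[OF P(1)]] geometric_factor_degree[OF P q(2)]
      not_coprime_cases[OF _ q(1)] B order_trans by blast
qed

lemma prime_case_M1:
  assumes M: "mersenne_prime_poly M" "M = [:1, 1, 1:]" and q: "prime q" "odd q"
  shows "has_non_mersenne_factor (\<Sum>i<q. M ^ i)"
proof (cases "q = 3 \<or> q = 7")
  case True
  then show ?thesis using exceptional_M1 M(2) by auto
next
  case False
  have irr: "irreducible M" using M by (simp add: mersenne_prime_poly_def)
  have deg: "4 \<le> d" if "q dvd 2 ^ d - 1" "d > 0" for d
    using prime_dvd_small_mersenne_number(1)[OF q(1) that] False by blast
  show ?thesis
    by (rule large_prime_factor[OF irr M(2)[unfolded mersenne_form(1)] _ q _ deg]) simp_all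
qed

lemma prime_case_M2:
  assumes M: "mersenne_prime_poly M" "M = [:1, 1, 0, 1:] \<or> M = [:1, 0, 1, 1:]"
    and q: "prime q" "odd q" "q \<noteq> 3"
  shows "has_non_mersenne_factor (\<Sum>i<q. M ^ i)"
proof (cases "q = 7")
  case True
  then show ?thesis using exceptional_M2 M(2) by auto
next
  case False
  have irr: "irreducible M" using M by (simp add: mersenne_prime_poly_def)
  note deg = prime_dvd_small_mersenne_number(1)[OF q(1) _ _ q(3) False]
  from M(2) show ?thesis
  proof
    assume "M = [:1, 1, 0, 1:]"
    then show ?thesis
      unfolding mersenne_form(2) by (rule large_prime_factor[OF irr _ _ q(1,2) _ deg]) simp_all
  next
    assume "M = [:1, 0, 1, 1:]"
    then show ?thesis
      unfolding mersenne_form(3) by (rule large_prime_factor[OF irr _ _ q(1,2) _ deg]) simp_all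
  qed
qed

lemma prime_case_M3:
  assumes M: "mersenne_prime_poly M" "M = [:1, 1, 1, 1, 1:] \<or> M = [:1, 0, 0, 1, 1:]"
    and q: "prime q" "odd q"
  shows "has_non_mersenne_factor (\<Sum>i<q. M ^ i)"
proof -
  have irr: "irreducible M" using M by (simp add: mersenne_prime_poly_def)
  obtain a b where ab: "M = 1 + polyX ^ a * (polyX + 1) ^ b" "a > 0" "b > 0" "a + b = 4"
  proof -
    from M(2) show ?thesis
    proof
      assume "M = [:1, 1, 1, 1, 1:]"
      from that[OF this[unfolded mersenne_form(4)]] show ?thesis by simp
    next
      assume "M = [:1, 0, 0, 1, 1:]"
      from that[OF this[unfolded mersenne_form(5)]] show ?thesis by simp
    qed
  qed
  consider "q = 3" | "q = 5 \<or> q = 7" | "q = 31" | "q \<noteq> 3" "q \<noteq> 5" "q \<noteq> 7" "q \<noteq> 31" by blast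
  then show ?thesis
  proof cases
    case 1
    then show ?thesis
      using cube_factor[OF irr ab(1-3)] ab(4) by (simp add: has_non_mersenne_factor_def)
  next
    case 2
    then show ?thesis using exceptional_M3 M(2) by auto
  next
    case 3
    then show ?thesis using mersenne_number_factor'[OF M(1), of 5] q by simp
  next
    case 4
    then have deg: "6 \<le> d" if "q dvd 2 ^ d - 1" "d > 0" for d
      using prime_dvd_small_mersenne_number(2)[OF q(1) that] by blast
    show ?thesis
      by (rule large_prime_factor[OF irr ab(1) _ q _ deg]) (simp_all add: ab(4))
  qed
qed

lemma has_non_mersenne_factor_dvd:
  assumes "has_non_mersenne_factor (\<Sum>i<q. M ^ i)" "M \<noteq> 1" "q dvd N"
  shows "has_non_mersenne_factor (\<Sum>i<N. M ^ i)"
  using assms geometric_dvd_geometric[OF assms(2,3)] dvd_trans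
  unfolding has_non_mersenne_factor_def by blast

theorem theorem1p2:
  fixes h :: nat and M :: "bit poly"
  assumes "h > 0"
    and "mersenne_prime_poly M"
    and "(M \<in> {Mersenne_M 1, Mersenne_M 3, bar_poly (Mersenne_M 3)} \<or> (M \<in> {Mersenne_M 2, bar_poly (Mersenne_M 2)} \<and> h \<ge> 2))
       \<or> (M \<notin> {Mersenne_M 1, Mersenne_M 2, bar_poly (Mersenne_M 2), Mersenne_M 3, bar_poly (Mersenne_M 3)}
           \<and> (\<exists>p \<in> Delta - {7}. p dvd 2 * h + 1))"
  shows "\<exists>P. irreducible P \<and> \<not> mersenne_prime_poly P \<and> P dvd sigma_poly (M ^ (2 * h))"
proof -
  define N where "N = 2 * h + 1"
  have irr: "irreducible M" using assms(2) by (simp add: mersenne_prime_poly_def)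
  have M1: "M \<noteq> 1" using irr by auto
  have oddq: "odd q" if "q dvd N" for q
    using that by (metis N_def dvd_trans even_mult_iff even_numeral odd_one odd_add)
  obtain q where q: "prime q" "q dvd N"
    using prime_factor_nat[of N] assms(1) by (auto simp: N_def)
  have "\<exists>r. r dvd N \<and> has_non_mersenne_factor (\<Sum>i<r. M ^ i)"
    using assms(3)
  proof (elim disjE conjE)
    assume "M \<in> {Mersenne_M 1, Mersenne_M 3, bar_poly (Mersenne_M 3)}"
    then have "M = [:1, 1, 1:] \<or> (M = [:1, 1, 1, 1, 1:] \<or> M = [:1, 0, 0, 1, 1:])"
      by (simp only: Mersenne_M_1 Mersenne_M_3 bar_poly_M3 insert_iff empty_iff) simp
    then show ?thesis
      using prime_case_M1[OF assms(2) _ q(1) oddq[OF q(2)]] prime_case_M3[OF assms(2) _ q(1) oddq[OF q(2)]] q(2)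
      by blast
  next
    assume h: "h \<ge> 2" and "M \<in> {Mersenne_M 2, bar_poly (Mersenne_M 2)}"
    then have M: "M = [:1, 1, 0, 1:] \<or> M = [:1, 0, 1, 1:]"
      by (simp only: Mersenne_M_2 bar_poly_M2 insert_iff empty_iff) simp
    show ?thesis
    proof (cases "\<exists>r. prime r \<and> r dvd N \<and> r \<noteq> 3")
      case True
      then show ?thesis using prime_case_M2[OF assms(2) M] oddq by blast
    next
      case False
      \<comment> \<open>All prime divisors of \<open>N\<close> equal 3, and \<open>N > 3\<close>
        because \<open>h\<close> is at least 2; hence 9 divides \<open>N\<close>.\<close>
      then have "q = 3" using q by blast
      then obtain k where k: "N = 3 * k" using q by blast
      then have "k \<noteq> 1" using h by (auto simp: N_def)
      then obtain r where r: "prime r" "r dvd k" using prime_factor_nat by blast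
      then have "r = 3" using False k by auto
      then have "9 dvd N" using r(2) k by auto
      moreover have "has_non_mersenne_factor (\<Sum>i<9. M ^ i)" using exceptional_M2 M by auto
      ultimately show ?thesis by blast
    qed
  next
    assume nM: "M \<notin> {Mersenne_M 1, Mersenne_M 2, bar_poly (Mersenne_M 2), Mersenne_M 3, bar_poly (Mersenne_M 3)}"
      and "\<exists>p \<in> Delta - {7}. p dvd 2 * h + 1"
    then obtain p where p: "p \<in> Delta" "p \<noteq> 7" "p dvd N" by (auto simp: N_def)
    then consider m where "prime p" "p = 2 ^ m - 1" | "prime p" "p \<noteq> 2" "8 dvd ord p 2"
      by (auto simp: Delta_def mersenne_prime_nat_def)
    then have "has_non_mersenne_factor (\<Sum>i<p. M ^ i)"
    proof cases
      case 1
      obtain a b where ab: "a > 0" "b > 0" "M = 1 + polyX ^ a * (polyX + 1) ^ b"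
        using assms(2) by (auto simp: mersenne_prime_poly_def)
      show ?thesis
      proof (cases "m \<ge> 5")
        case True
        then show ?thesis using mersenne_number_factor'[OF assms(2)] 1 by blast
      next
        case False
        \<comment> \<open>Among the values 0, 1, 3, 7 and 15 of \<open>2^m - 1\<close> only 3 and 7
          are prime, and 7 is excluded.\<close>
        then have "m \<in> {0, 1, 2, 3, 4}" by auto
        moreover have "\<not> prime (15 :: nat)" by simp
        ultimately have "p = 3" using 1 p(2) by auto
        moreover have "a + b \<ge> 4"
        proof (rule ccontr)
          assume "\<not> a + b \<ge> 4"
          \<comment> \<open>Degrees 2 and 3 leave only \<open>M_1\<close>, \<open>M_2\<close> and
            the conjugate of \<open>M_2\<close>, which this case excludes.\<close>
          then have "(a = 1 \<and> b = 1) \<or> (a = 1 \<and> b = 2) \<or> (a = 2 \<and> b = 1)"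
            using ab(1,2) by linarith
          then have "M = [:1, 1, 1:] \<or> M = [:1, 1, 0, 1:] \<or> M = [:1, 0, 1, 1:]"
            unfolding mersenne_form ab(3) by blast
          then show False
            using nM by (simp only: Mersenne_M_1 Mersenne_M_2 bar_poly_M2 insert_iff) blast
        qed
        ultimately show ?thesis
          using cube_factor[OF irr ab(3,1,2)] by (simp add: has_non_mersenne_factor_def)
      qed
    next
      case 2
      then show ?thesis
        using order_8_factor[OF irreducible_degree_pos[OF irr]] by (simp add: has_non_mersenne_factor_def)
    qed
    then show ?thesis using p(3) by blast
  qed
  then have "has_non_mersenne_factor (\<Sum>i<N. M ^ i)"
    using has_non_mersenne_factor_dvd M1 by blast
  moreover have "sigma_poly (M ^ (2 * h)) = (\<Sum>i<N. M ^ i)"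
    by (simp only: sigma_poly_irreducible_power[OF irr] N_def Suc_eq_plus1)
  ultimately show ?thesis by (simp only: has_non_mersenne_factor_def)
qed

end
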